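(* Let $X$ be a locally compact metrizable space, $\phi:X\to X$ a homeomorphism, and $\mathcal A=C_0(X)\times_\phi\mathbb Z_+$ the semicrossed product. Let $X_p$ be the largest perfect subset of $X$ and $\overline{X_r}$ the closure of the set of recurrent points of $(X,\phi)$. Then the hypocompact radical of $\mathcal A$ is $$\mathcal A_{hc}=\{A\in\mathcal A:\ E_0(A)(x)=0 \text{ for all } x\in X_p,\ \text{and } E_n(A)(x)=0 \text{ for all } x\in \overline{X_r} \text{ and all } n\in\mathbb Z_+\}.$$ Equivalently, $\overline{X_r}$ may be replaced by the set $X_{\gamma_0}$ at which the transfinite sequence of iterated non-wandering sets stabilizes.
   Context: Semicrossed product: let $X$ be a locally compact metrizable space and $\phi:X\to X$ a homeomorphism; set $\alpha_n(f)=f\circ\phi^n$. On $\ell^1(\mathbb Z_+,C_0(X))$, elements written as formal series $\sum_{n\ge0}U^nf_n$ with norm $\sum_n\|f_n\|_\infty$, multiplication is $U^nf\,U^mg=U^{n+m}(\alpha_m(f)g)$. Representing on $\mathcal H_0\otimes\ell^2(\mathbb Z_+)$ (with $C_0(X)$ acting faithfully on $\mathcal H_0$) by $\pi(U^nf)(\xi\otimes e_k)=\alpha_k(f)\xi\otimes e_{k+n}$, the semicrossed product $\mathcal A$ is the operator-norm closure of the image. The Fourier coefficient maps $E_n(\sum U^mf_m)=f_n$ extend to contractions $E_n:\mathcal A\to C_0(X)$, and $A=0$ iff all $E_n(A)=0$. A point $x\in X$ is recurrent if there is a strictly increasing sequence $n_i$ of positive integers with $\phi^{n_i}(x)\to x$;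 $X_r$ denotes the set of recurrent points. Every space is uniquely a disjoint union of a perfect set $X_p$ (closed, no isolated points) and a scattered set (containing no nonempty subset without isolated points). Iterated non-wandering sets: $Y\subseteq X$ is wandering if $\phi^m(Y)\cap\phi^n(Y)=\emptyset$ for $m\neq n$ in $\mathbb Z_+$; a point is wandering if it has an open wandering neighbourhood. $X_1$ is the set of non-wandering points; $X_{\gamma+1}$ is the set of non-wandering points of $(X_\gamma,\phi|_{X_\gamma})$; for limit $\gamma$, $X_\gamma=\bigcap_{\beta<\gamma}X_\beta$; this stabilizes at an ordinal $\gamma_0$, and $X_{\gamma_0}=\overline{X_r}$. Hypocompactness: $a\in\mathcal B$ is a compact element if $x\mapsto axa$ is a compact operator on $\mathcal B$; $\mathcal B$ is hypocompact if every nonzero quotient by a closed ideal has a nonzero compact element; $\mathcal B_{hc}$ is the largest hypocompact ideal of $\mathcal B$ (it exists and is closed). *)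

theory Defs
  imports "HOL-Analysis.Analysis" "HOL-Library.Function_Algebras"
begin

definition C0 :: "'a topology \<Rightarrow> ('a \<Rightarrow> complex) set" where
  "C0 X = {f. continuous_map X euclidean f \<and> (\<forall>x. x \<notin> topspace X \<longrightarrow> f x = 0) \<and>
             (\<forall>e>0. \<exists>K. compactin X K \<and> (\<forall>x \<in> topspace X - K. cmod (f x) < e))}"

definition recurrent_points :: "'a topology \<Rightarrow> ('a \<Rightarrow> 'a) \<Rightarrow> 'a set" where
  "recurrent_points X \<phi> = {x \<in> topspace X. \<exists>r::nat \<Rightarrow> nat. strict_mono r \<and> (\<forall>i. 0 < r i) \<and>
        limitin X (\<lambda>i. (\<phi> ^^ r i) x) x sequentially}"

definition perfect_part :: "'a topology \<Rightarrow> 'a set" where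
  "perfect_part X = \<Union>{P. P \<subseteq> topspace X \<and> closedin X P \<and> P \<subseteq> X derived_set_of P}"

text \<open>An element A is identified with its sequence of Fourier coefficients n \<mapsto> E_n(A).
  We use the faithful representation of C_0(X) on H_0 = l^2(X) by multiplication, so
  H_0 \<otimes> l^2(Z_+) = l^2(X \<times> Z_+), and pi(A)(delta_x \<otimes> e_j) = \<Sum>_n E_n(A)(phi^j x) delta_x \<otimes> e_(j+n).
  Matrix entries of pi(A):\<close>
definition scp_matrix :: "('a \<Rightarrow> 'a) \<Rightarrow> (nat \<Rightarrow> 'a \<Rightarrow> complex) \<Rightarrow> 'a \<times> nat \<Rightarrow> 'a \<times> nat \<Rightarrow> complex" where
  "scp_matrix \<phi> a p q = (if fst p = fst q \<and> snd q \<le> snd p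
       then a (snd p - snd q) ((\<phi> ^^ snd q) (fst q)) else 0)"

definition admissible :: "'a topology \<Rightarrow> ('a \<times> nat) set \<Rightarrow> ('a \<times> nat \<Rightarrow> complex) \<Rightarrow> ('a \<times> nat \<Rightarrow> complex) \<Rightarrow> bool" where
  "admissible X S u v \<longleftrightarrow> finite S \<and> S \<subseteq> topspace X \<times> UNIV \<and>
      (\<Sum>p\<in>S. (cmod (u p))\<^sup>2) \<le> 1 \<and> (\<Sum>p\<in>S. (cmod (v p))\<^sup>2) \<le> 1"

definition scp_bil :: "('a \<Rightarrow> 'a) \<Rightarrow> (nat \<Rightarrow> 'a \<Rightarrow> complex) \<Rightarrow> ('a \<times> nat) set \<Rightarrow> ('a \<times> nat \<Rightarrow> complex) \<Rightarrow> ('a \<times> nat \<Rightarrow> complex) \<Rightarrow> complex" where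
  "scp_bil \<phi> a S u v = (\<Sum>p\<in>S. \<Sum>q\<in>S. cnj (u p) * scp_matrix \<phi> a p q * v q)"

text \<open>Operator norm of pi(A) (sup over finitely supported unit vectors, which are dense).\<close>
definition scp_norm :: "'a topology \<Rightarrow> ('a \<Rightarrow> 'a) \<Rightarrow> (nat \<Rightarrow> 'a \<Rightarrow> complex) \<Rightarrow> real" where
  "scp_norm X \<phi> a = Sup {cmod (scp_bil \<phi> a S u v) | S u v. admissible X S u v}"

text \<open>The semicrossed product: operator-norm closure of the polynomials \<Sum>_{n<N} U^n f_n.\<close>
definition semicrossed :: "'a topology \<Rightarrow> ('a \<Rightarrow> 'a) \<Rightarrow> (nat \<Rightarrow> 'a \<Rightarrow> complex) set" where
  "semicrossed X \<phi> = {a. (\<forall>n. a n \<in> C0 X) \<and>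
     (\<exists>p :: nat \<Rightarrow> nat \<Rightarrow> 'a \<Rightarrow> complex.
        (\<forall>m n. p m n \<in> C0 X) \<and> (\<forall>m. \<exists>N. \<forall>n\<ge>N. p m n = 0) \<and>
        (\<forall>e>0. \<exists>M. \<forall>m\<ge>M. \<forall>S u v. admissible X S u v \<longrightarrow>
             cmod (scp_bil \<phi> (a - p m) S u v) \<le> e))}"

text \<open>Product: U^n f U^m g = U^(n+m) (alpha_m(f) g), hence
  E_n(AB) = \<Sum>_{m\<le>n} alpha_(n-m)(E_m A) E_(n-m) B.\<close>
definition scp_mult :: "('a \<Rightarrow> 'a) \<Rightarrow> (nat \<Rightarrow> 'a \<Rightarrow> complex) \<Rightarrow> (nat \<Rightarrow> 'a \<Rightarrow> complex) \<Rightarrow> (nat \<Rightarrow> 'a \<Rightarrow> complex)" where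
  "scp_mult \<phi> a b = (\<lambda>n x. \<Sum>m\<le>n. a m ((\<phi> ^^ (n - m)) x) * b (n - m) x)"

definition scp_scale :: "complex \<Rightarrow> (nat \<Rightarrow> 'a \<Rightarrow> complex) \<Rightarrow> (nat \<Rightarrow> 'a \<Rightarrow> complex)" where
  "scp_scale c a = (\<lambda>n x. c * a n x)"

text \<open>An algebra is given by a carrier B (closed under the operations), a product mul,
  complex scalar multiplication sc and a norm nrm; addition is that of the ambient type.\<close>

definition is_ideal :: "'b::ab_group_add set \<Rightarrow> ('b \<Rightarrow> 'b \<Rightarrow> 'b) \<Rightarrow> (complex \<Rightarrow> 'b \<Rightarrow> 'b) \<Rightarrow> 'b set \<Rightarrow> bool" where
  "is_ideal B mul sc J \<longleftrightarrow> J \<subseteq> B \<and> 0 \<in> J \<and> (\<forall>x\<in>J. \<forall>y\<in>J. x + y \<in> J) \<and> (\<forall>x\<in>J. - x \<in> J) \<and>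
     (\<forall>c. \<forall>x\<in>J. sc c x \<in> J) \<and> (\<forall>a\<in>B. \<forall>x\<in>J. mul a x \<in> J \<and> mul x a \<in> J)"

definition closed_in_alg :: "'b::ab_group_add set \<Rightarrow> ('b \<Rightarrow> real) \<Rightarrow> 'b set \<Rightarrow> bool" where
  "closed_in_alg B nrm K \<longleftrightarrow> (\<forall>k x. (\<forall>i. k i \<in> K) \<and> x \<in> B \<and> (\<lambda>i. nrm (k i - x)) \<longlonglongrightarrow> 0 \<longrightarrow> x \<in> K)"

definition quot_norm :: "('b::ab_group_add \<Rightarrow> real) \<Rightarrow> 'b set \<Rightarrow> 'b \<Rightarrow> real" where
  "quot_norm nrm K x = Inf ((\<lambda>k. nrm (x - k)) ` K)"

text \<open>a + K is a compact element of B/K: the operator y + K \<mapsto> a y a + K maps the closed unit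
  ball of B/K to a relatively compact subset of B/K (sequential characterisation, valid in
  the metric space B/K).\<close>
definition compact_elem_quot :: "'b::ab_group_add set \<Rightarrow> ('b \<Rightarrow> 'b \<Rightarrow> 'b) \<Rightarrow> ('b \<Rightarrow> real) \<Rightarrow> 'b set \<Rightarrow> 'b \<Rightarrow> bool" where
  "compact_elem_quot B mul nrm K a \<longleftrightarrow>
     (\<forall>y::nat \<Rightarrow> 'b. (\<forall>i. y i \<in> B \<and> quot_norm nrm K (y i) \<le> 1) \<longrightarrow>
        (\<exists>r z. strict_mono r \<and> z \<in> B \<and>
           (\<lambda>i. quot_norm nrm K (mul (mul a (y (r i))) a - z)) \<longlonglongrightarrow> 0))"

definition hypocompact :: "'b::ab_group_add set \<Rightarrow> ('b \<Rightarrow> 'b \<Rightarrow> 'b) \<Rightarrow> (complex \<Rightarrow> 'b \<Rightarrow> 'b) \<Rightarrow> ('b \<Rightarrow> real) \<Rightarrow> bool" where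
  "hypocompact B mul sc nrm \<longleftrightarrow>
     (\<forall>K. is_ideal B mul sc K \<and> closed_in_alg B nrm K \<and> K \<noteq> B \<longrightarrow>
        (\<exists>a\<in>B. a \<notin> K \<and> compact_elem_quot B mul nrm K a))"

definition is_hypocompact_radical :: "'b::ab_group_add set \<Rightarrow> ('b \<Rightarrow> 'b \<Rightarrow> 'b) \<Rightarrow> (complex \<Rightarrow> 'b \<Rightarrow> 'b) \<Rightarrow> ('b \<Rightarrow> real) \<Rightarrow> 'b set \<Rightarrow> bool" where
  "is_hypocompact_radical B mul sc nrm H \<longleftrightarrow>
     is_ideal B mul sc H \<and> hypocompact H mul sc nrm \<and>
     (\<forall>J. is_ideal B mul sc J \<and> hypocompact J mul sc nrm \<longrightarrow> J \<subseteq> H)"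

end

(* The operators of the semicrossed product leave the fibres l^2({x} x Z_+) invariant and act there
   by lower triangular matrices, so truncations are multiplicative and the norm is the supremum
   over fibres and truncations.

   The candidate ideal J contains every hypocompact ideal I: modulo the intersection of I and J,
   let a in I be compact. If a has a nonzero lowest coefficient a_n at a recurrent point x, then
   inserting U^k h a U^l h' between two copies of a produces bounded sequences whose coefficients
   at x stay away from 0 in degrees tending to infinity, whereas the coefficients of a limit tend
   to 0. If a_0 does not vanish at a point of the perfect part, inserting h_i a with separated
   bumps h_i around infinitely many nearby points gives a sequence without Cauchy subsequence.

   J is hypocompact: let K be a closed ideal of J such that J/K has no nonzero compact element, and
   let V be the largest open set off the closure Y of the recurrent points with U^n f in K for all
   n >= 1 and f in C_0(V). If V misses a point off Y, Baire's theorem provides an open set G that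
   meets the complement Z of V and satisfies p in G, phi^k(p) not in G for p in G and Z, k >= 1. For f
   in C_0(G) and n >= 1, multiplication by a = U^n f from both sides maps J into K, so a is compact,
   hence in K, contradicting maximality. The same argument in degree 0 uses isolated points of the
   part of the scattered set not yet reached: there two-sided multiplication by f has rank at most
   one modulo K. Finally Cesaro means show that J = K. *)

theory Submission
  imports Defs
begin

section \<open>Operator norms read off the truncated lower triangular matrices of single
  fibres\<close>

section \<open>Operator bounds on fibres\<close>

text \<open>The block of \<open>pi(a)\<close> on the fibre over \<open>x\<close>, a lower triangular
  matrix. Each output coordinate is a finite sum, so it acts on arbitrary sequences and no l^2
  condition has to be carried along.\<close>

definition fiber_op :: "('a \<Rightarrow> 'a) \<Rightarrow> (nat \<Rightarrow> 'a \<Rightarrow> complex) \<Rightarrow> 'a \<Rightarrow> (nat \<Rightarrow> complex) \<Rightarrow> nat \<Rightarrow> complex" where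
  "fiber_op \<phi> a x v i = (\<Sum>j\<le>i. a (i - j) ((\<phi> ^^ j) x) * v j)"

definition fiber_form :: "('a \<Rightarrow> 'a) \<Rightarrow> (nat \<Rightarrow> 'a \<Rightarrow> complex) \<Rightarrow> 'a \<Rightarrow> nat \<Rightarrow> (nat \<Rightarrow> complex) \<Rightarrow> (nat \<Rightarrow> complex) \<Rightarrow> complex" where
  "fiber_form \<phi> a x N u v = (\<Sum>i<N. cnj (u i) * fiber_op \<phi> a x v i)"

definition sqn :: "nat \<Rightarrow> (nat \<Rightarrow> complex) \<Rightarrow> real" where
  "sqn N v = (\<Sum>i<N. (cmod (v i))\<^sup>2)"

text \<open>For lower triangular matrices, a common bound on all truncations is the same as a bound
  on the operator. Estimates are made with this predicate because the \<open>Sup\<close> in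
  \<open>scp_norm\<close> says nothing until its set is known to be bounded.\<close>

definition op_bound :: "'a topology \<Rightarrow> ('a \<Rightarrow> 'a) \<Rightarrow> (nat \<Rightarrow> 'a \<Rightarrow> complex) \<Rightarrow> real \<Rightarrow> bool" where
  "op_bound X \<phi> a c \<longleftrightarrow> 0 \<le> c \<and> (\<forall>x\<in>topspace X. \<forall>v N. sqn N (fiber_op \<phi> a x v) \<le> c\<^sup>2 * sqn N v)"

lemma sqn_nonneg: "0 \<le> sqn N v"
  unfolding sqn_def by (intro sum_nonneg) auto

lemma op_bound_nonneg: "op_bound X \<phi> a c \<Longrightarrow> 0 \<le> c"
  by (simp add: op_bound_def)

lemma op_boundD: "op_bound X \<phi> a c \<Longrightarrow> x \<in> topspace X \<Longrightarrow> sqn N (fiber_op \<phi> a x v) \<le> c\<^sup>2 * sqn N v"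
  by (simp add: op_bound_def)

text \<open>Weighted arithmetic-geometric mean in each coordinate, in place of Cauchy-Schwarz. The
  bound is additive in the squared norms, so it can later be summed over fibres and over
  windows.\<close>

lemma cmod_sum_cnj_le:
  assumes "0 < t"
  shows "cmod (\<Sum>i<N. cnj (u i) * w i) \<le> (t * sqn N u + sqn N w / t) / 2"
proof -
  have "cmod (u i) * cmod (w i) \<le> (t * (cmod (u i))\<^sup>2 + (cmod (w i))\<^sup>2 / t) / 2" for i
  proof -
    have "0 \<le> (t * cmod (u i) - cmod (w i))\<^sup>2 / t"
      using assms by simp
    also have "\<dots> = t * (cmod (u i))\<^sup>2 + (cmod (w i))\<^sup>2 / t - 2 * (cmod (u i) * cmod (w i))"
      using assms by (simp add: power2_eq_square field_simps)
    finally show ?thesis by simp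
  qed
  then have "(\<Sum>i<N. cmod (u i) * cmod (w i)) \<le> (\<Sum>i<N. (t * (cmod (u i))\<^sup>2 + (cmod (w i))\<^sup>2 / t) / 2)"
    by (rule sum_mono)
  also have "\<dots> = (t * sqn N u + sqn N w / t) / 2"
    by (simp add: sqn_def sum.distrib sum_distrib_left flip: sum_divide_distrib)
  finally have "(\<Sum>i<N. cmod (u i) * cmod (w i)) \<le> (t * sqn N u + sqn N w / t) / 2" .
  moreover have "cmod (\<Sum>i<N. cnj (u i) * w i) \<le> (\<Sum>i<N. cmod (u i) * cmod (w i))"
    by (rule order_trans[OF norm_sum]) (simp add: norm_mult)
  ultimately show ?thesis by linarith
qed

lemma sum_cnj_self: "(\<Sum>i<N. cnj (w i) * w i) = of_real (sqn N w)"
  unfolding sqn_def of_real_sum complex_norm_square by (simp add: mult.commute)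

text \<open>The weight \<open>t = c\<close> balances the two terms; \<open>c = 0\<close> is treated
  apart because the weight must be positive.\<close>

lemma fiber_form_le:
  assumes "op_bound X \<phi> a c" "x \<in> topspace X"
  shows "cmod (fiber_form \<phi> a x N u v) \<le> c * (sqn N u + sqn N v) / 2"
proof (cases "c = 0")
  case True
  then have "sqn N (fiber_op \<phi> a x v) \<le> 0"
    using op_boundD[OF assms, of N v] by simp
  then have "\<forall>i<N. fiber_op \<phi> a x v i = 0"
    using sqn_nonneg[of N "fiber_op \<phi> a x v"]
    by (subst (asm) sqn_def) (auto simp: sqn_def sum_nonneg_eq_0_iff dest: antisym)
  then show ?thesis using True by (simp add: fiber_form_def)
next
  case False
  then have c: "0 < c" using op_bound_nonneg[OF assms(1)] by simp
  have "cmod (fiber_form \<phi> a x N u v) \<le> (c * sqn N u + sqn N (fiber_op \<phi> a x v) / c) / 2"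
    unfolding fiber_form_def by (rule cmod_sum_cnj_le[OF c])
  also have "\<dots> \<le> (c * sqn N u + c * sqn N v) / 2"
    using op_boundD[OF assms, of N v] c by (simp add: field_simps power2_eq_square)
  finally show ?thesis by (simp add: algebra_simps)
qed

lemma fiber_form_scaled_self: "fiber_form \<phi> a x N (\<lambda>i. of_real t * fiber_op \<phi> a x v i) v = of_real (t * sqn N (fiber_op \<phi> a x v))"
  unfolding fiber_form_def of_real_mult sum_cnj_self[symmetric]
  by (simp add: sum_distrib_left mult_ac)

lemma sqn_scale: "sqn N (\<lambda>i. s * v i) = (cmod s)\<^sup>2 * sqn N v"
  by (simp add: sqn_def norm_mult power_mult_distrib sum_distrib_left)

text \<open>Converse of \<open>fiber_form_le\<close>: test with \<open>1 / c\<close> times the image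
  vector. Its own contribution on the right is then half of the left side and can be
  absorbed.\<close>

lemma op_boundI_form:
  assumes c: "0 \<le> c"
    and le: "\<And>x N u v. x \<in> topspace X \<Longrightarrow> cmod (fiber_form \<phi> a x N u v) \<le> c * (sqn N u + sqn N v) / 2"
  shows "op_bound X \<phi> a c"
  unfolding op_bound_def
proof (intro conjI ballI allI c)
  fix x v N assume x: "x \<in> topspace X"
  let ?w = "fiber_op \<phi> a x v"
  have *: "t * sqn N ?w \<le> c * (t\<^sup>2 * sqn N ?w + sqn N v) / 2" if "0 < t" for t
    using le[OF x, of N "\<lambda>i. of_real t * ?w i" v] that
    by (simp add: fiber_form_scaled_self sqn_scale norm_mult sqn_nonneg del: of_real_mult)
  show "sqn N ?w \<le> c\<^sup>2 * sqn N v"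
  proof (cases "c = 0")
    case True
    then show ?thesis using *[of 1] by simp
  next
    case False
    then have "0 < c" using c by simp
    then show ?thesis using *[of "1/c"] by (simp add: field_simps power2_eq_square)
  qed
qed

lemma fiber_form_eq:
  "fiber_form \<phi> a x N u v = (\<Sum>i<N. \<Sum>j<N. cnj (u i) * (if j \<le> i then a (i - j) ((\<phi> ^^ j) x) else 0) * v j)"
  unfolding fiber_form_def fiber_op_def
proof (rule sum.cong[OF refl])
  fix i assume "i \<in> {..<N}"
  then have *: "{..i} = {..<N} \<inter> {j. j \<le> i}" by auto
  show "cnj (u i) * (\<Sum>j\<le>i. a (i - j) ((\<phi> ^^ j) x) * v j) =
      (\<Sum>j<N. cnj (u i) * (if j \<le> i then a (i - j) ((\<phi> ^^ j) x) else 0) * v j)"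
    unfolding * sum_distrib_left
    by (subst sum.inter_restrict) (auto intro!: sum.cong)
qed

lemma scp_bil_product:
  assumes "finite F"
  shows "scp_bil \<phi> a (F \<times> {..<N}) u v = (\<Sum>x\<in>F. fiber_form \<phi> a x N (\<lambda>i. u (x, i)) (\<lambda>i. v (x, i)))"
proof -
  have "(\<Sum>q\<in>F \<times> {..<N}. cnj (u (x, i)) * scp_matrix \<phi> a (x, i) q * v q) =
    (\<Sum>j<N. cnj (u (x,i)) * (if j \<le> i then a (i - j) ((\<phi> ^^ j) x) else 0) * v (x,j))" if "x \<in> F" for x i
  proof -
    have "(\<Sum>q\<in>F \<times> {..<N}. cnj (u (x, i)) * scp_matrix \<phi> a (x, i) q * v q) =
      (\<Sum>y\<in>F. \<Sum>j<N. cnj (u (x, i)) * scp_matrix \<phi> a (x, i) (y, j) * v (y, j))"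
      by (simp add: sum.cartesian_product)
    also have "\<dots> = (\<Sum>y\<in>F. if y = x then \<Sum>j<N. cnj (u (x,i)) * (if j \<le> i then a (i - j) ((\<phi> ^^ j) x) else 0) * v (x,j) else 0)"
      by (intro sum.cong) (auto simp: scp_matrix_def intro!: sum.cong)
    finally show ?thesis using assms that by simp
  qed
  then show ?thesis
    unfolding scp_bil_def fiber_form_eq by (simp add: sum.cartesian_product')
qed

text \<open>Distinct fibres are orthogonal. Once \<open>S\<close> is enlarged to a rectangle, the
  form splits into fibre forms and their additive bounds add up.\<close>

lemma scp_bil_le:
  assumes "op_bound X \<phi> a c" "admissible X S u v"
  shows "cmod (scp_bil \<phi> a S u v) \<le> c"
proof -
  have S: "finite S" "S \<subseteq> topspace X \<times> UNIV" "(\<Sum>p\<in>S. (cmod (u p))\<^sup>2) \<le> 1" "(\<Sum>p\<in>S. (cmod (v p))\<^sup>2) \<le> 1"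
    using assms(2) by (auto simp: admissible_def)
  define F where "F = fst ` S"
  have F: "finite F" "F \<subseteq> topspace X" using S by (auto simp: F_def)
  obtain N where N: "snd ` S \<subseteq> {..<N}"
    using finite_nat_set_iff_bounded[of "snd ` S"] S(1) by auto
  have sub: "S \<subseteq> F \<times> {..<N}" using N by (force simp: F_def)
  \<comment> \<open>Extension by zero from \<open>S\<close> to the rectangle changes neither the
    form nor the squared norms.\<close>
  define r where "r w p = (if p \<in> S then w p else 0)" for w :: "'a \<times> nat \<Rightarrow> complex" and p
  have fin: "finite (F \<times> {..<N})" using F by simp
  have sq: "(\<Sum>x\<in>F. sqn N (\<lambda>i. r w (x, i))) = (\<Sum>p\<in>S. (cmod (w p))\<^sup>2)" for w
  proof -
    have "(\<Sum>x\<in>F. sqn N (\<lambda>i. r w (x, i))) = (\<Sum>p\<in>F \<times> {..<N}. (cmod (r w p))\<^sup>2)"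
      by (simp add: sqn_def sum.cartesian_product)
    also have "\<dots> = (\<Sum>p\<in>S. (cmod (r w p))\<^sup>2)"
      by (rule sum.mono_neutral_right[OF fin sub]) (auto simp: r_def)
    also have "\<dots> = (\<Sum>p\<in>S. (cmod (w p))\<^sup>2)"
      by (rule sum.cong) (auto simp: r_def)
    finally show ?thesis .
  qed
  have "scp_bil \<phi> a S u v = scp_bil \<phi> a (F \<times> {..<N}) (r u) (r v)"
  proof -
    have "scp_bil \<phi> a (F \<times> {..<N}) (r u) (r v) = (\<Sum>p\<in>S. \<Sum>q\<in>F \<times> {..<N}. cnj (r u p) * scp_matrix \<phi> a p q * r v q)"
      unfolding scp_bil_def by (rule sum.mono_neutral_right[OF fin sub]) (auto simp: r_def)
    also have "\<dots> = (\<Sum>p\<in>S. \<Sum>q\<in>S. cnj (r u p) * scp_matrix \<phi> a p q * r v q)"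
      by (intro sum.cong refl sum.mono_neutral_right[OF fin sub]) (auto simp: r_def)
    also have "\<dots> = scp_bil \<phi> a S u v"
      unfolding scp_bil_def by (intro sum.cong refl) (auto simp: r_def)
    finally show ?thesis ..
  qed
  also have "\<dots> = (\<Sum>x\<in>F. fiber_form \<phi> a x N (\<lambda>i. r u (x, i)) (\<lambda>i. r v (x, i)))"
    by (rule scp_bil_product[OF F(1)])
  also have "cmod \<dots> \<le> (\<Sum>x\<in>F. c * (sqn N (\<lambda>i. r u (x, i)) + sqn N (\<lambda>i. r v (x, i))) / 2)"
    using F by (intro sum_norm_le fiber_form_le[OF assms(1)]) auto
  also have "\<dots> = c * ((\<Sum>p\<in>S. (cmod (u p))\<^sup>2) + (\<Sum>p\<in>S. (cmod (v p))\<^sup>2)) / 2"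
    by (simp add: sq[symmetric] flip: sum_divide_distrib sum_distrib_left sum.distrib)
  also have "\<dots> \<le> c * 2 / 2"
    using S op_bound_nonneg[OF assms(1)] by (intro divide_right_mono mult_left_mono) auto
  finally show ?thesis by simp
qed

text \<open>A single fibre is tested with \<open>v\<close> and its image, both normalised; the form
  then equals the ratio \<open>s / t\<close> of their lengths.\<close>

lemma op_boundI_bil:
  assumes c: "0 \<le> c" and le: "\<And>S u v. admissible X S u v \<Longrightarrow> cmod (scp_bil \<phi> a S u v) \<le> c"
  shows "op_bound X \<phi> a c"
  unfolding op_bound_def
proof (intro conjI ballI allI c)
  fix x v N assume x: "x \<in> topspace X"
  let ?w = "fiber_op \<phi> a x v"
  show "sqn N ?w \<le> c\<^sup>2 * sqn N v"
  \<comment> \<open>Normalising needs positive lengths. If \<open>v\<close> vanishes below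
    \<open>N\<close>, so does its image, by triangularity.\<close>
  proof (cases "sqn N ?w = 0 \<or> sqn N v = 0")
    case True
    moreover have "sqn N ?w = 0" if "sqn N v = 0"
    proof -
      have "\<forall>i<N. v i = 0" using that by (auto simp: sqn_def sum_nonneg_eq_0_iff)
      then show ?thesis by (auto simp: sqn_def fiber_op_def)
    qed
    ultimately show ?thesis using sqn_nonneg[of N v] by auto
  next
    case False
    define s t where "s = sqrt (sqn N ?w)" and "t = sqrt (sqn N v)"
    have pos: "0 < s" "0 < t" "s\<^sup>2 = sqn N ?w" "t\<^sup>2 = sqn N v"
      using False sqn_nonneg[of N ?w] sqn_nonneg[of N v] by (auto simp: s_def t_def)
    define u' where "u' = (\<lambda>p::'a \<times> nat. of_real (1/s) * ?w (snd p))"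
    define v' where "v' = (\<lambda>p::'a \<times> nat. of_real (1/t) * v (snd p))"
    have ad: "admissible X ({x} \<times> {..<N}) u' v'"
      using x pos sqn_scale[of N "of_real (1/s)" ?w] sqn_scale[of N "of_real (1/t)" v]
      by (simp add: admissible_def sum.cartesian_product' u'_def v'_def sqn_def[symmetric] power_divide
           del: of_real_divide) (auto simp: norm_divide)
    have "fiber_op \<phi> a x (\<lambda>i. of_real (1/t) * v i) i = of_real (1/t) * ?w i" for i
      by (simp add: fiber_op_def sum_distrib_left mult_ac)
    then have "scp_bil \<phi> a ({x} \<times> {..<N}) u' v' = of_real (1/s) * of_real (1/t) * of_real (sqn N ?w)"
      by (simp add: scp_bil_product u'_def v'_def fiber_form_def sum_cnj_self[symmetric] sum_distrib_left mult_ac)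
    also have "\<dots> = of_real (s / t)"
      using pos by (simp add: pos(3)[symmetric] power2_eq_square)
    finally have "s / t \<le> c" using le[OF ad] pos by (simp add: norm_divide)
    then have "s\<^sup>2 \<le> (c * t)\<^sup>2"
      using pos by (intro power_mono) (auto simp: field_simps)
    then show ?thesis by (simp add: pos power_mult_distrib)
  qed
qed

lemma scp_norm_le: "op_bound X \<phi> a c \<Longrightarrow> scp_norm X \<phi> a \<le> c"
proof -
  have "admissible X {} (\<lambda>_. 0) (\<lambda>_. 0)" by (simp add: admissible_def)
  then show "op_bound X \<phi> a c \<Longrightarrow> scp_norm X \<phi> a \<le> c"
    unfolding scp_norm_def by (intro cSup_least) (auto simp: scp_bil_le)
qed

text \<open>Any bound at all makes the set under the \<open>Sup\<close> bounded above, and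
  \<open>scp_norm\<close> becomes a genuine least upper bound.\<close>

lemma op_bound_scp_norm:
  assumes "op_bound X \<phi> a c"
  shows "op_bound X \<phi> a (scp_norm X \<phi> a)"
proof -
  have bdd: "bdd_above {cmod (scp_bil \<phi> a S u v) | S u v. admissible X S u v}"
    using scp_bil_le[OF assms] by (auto simp: bdd_above_def)
  have le: "cmod (scp_bil \<phi> a S u v) \<le> scp_norm X \<phi> a" if "admissible X S u v" for S u v
    unfolding scp_norm_def using that by (intro cSup_upper[OF _ bdd]) auto
  have "0 \<le> scp_norm X \<phi> a"
    using le[of "{}" "\<lambda>_. 0" "\<lambda>_. 0"] by (simp add: admissible_def scp_bil_def)
  then show ?thesis using le by (rule op_boundI_bil)
qed

lemma scp_norm_nonneg: "op_bound X \<phi> a c \<Longrightarrow> 0 \<le> scp_norm X \<phi> a"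
  using op_bound_scp_norm op_bound_nonneg by blast

lemma op_bound_mono: "op_bound X \<phi> a c \<Longrightarrow> c \<le> d \<Longrightarrow> op_bound X \<phi> a d"
  unfolding op_bound_def
  by (smt (verit, best) mult_right_mono power_mono sqn_nonneg)

lemma fiber_op_add: "fiber_op \<phi> (a + b) x v i = fiber_op \<phi> a x v i + fiber_op \<phi> b x v i"
  by (simp add: fiber_op_def sum.distrib algebra_simps)

lemma fiber_op_scp_scale: "fiber_op \<phi> (scp_scale s a) x v i = s * fiber_op \<phi> a x v i"
  by (simp add: fiber_op_def scp_scale_def sum_distrib_left mult_ac)

lemma op_bound_add:
  assumes "op_bound X \<phi> a c" "op_bound X \<phi> b d"
  shows "op_bound X \<phi> (a + b) (c + d)"
proof (rule op_boundI_form)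
  show "0 \<le> c + d" using assms op_bound_nonneg by (meson add_nonneg_nonneg)
  fix x N u v assume x: "x \<in> topspace X"
  have "fiber_form \<phi> (a + b) x N u v = fiber_form \<phi> a x N u v + fiber_form \<phi> b x N u v"
    by (simp add: fiber_form_def fiber_op_add sum.distrib algebra_simps)
  also have "cmod \<dots> \<le> c * (sqn N u + sqn N v) / 2 + d * (sqn N u + sqn N v) / 2"
    by (intro norm_triangle_mono fiber_form_le[OF assms(1) x] fiber_form_le[OF assms(2) x])
  finally show "cmod (fiber_form \<phi> (a + b) x N u v) \<le> (c + d) * (sqn N u + sqn N v) / 2"
    by (simp add: algebra_simps add_divide_distrib)
qed

lemma op_bound_scale:
  assumes "op_bound X \<phi> a c"
  shows "op_bound X \<phi> (scp_scale s a) (cmod s * c)"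
  unfolding op_bound_def
proof (intro conjI ballI allI)
  show "0 \<le> cmod s * c" using op_bound_nonneg[OF assms] by simp
  fix x v N assume x: "x \<in> topspace X"
  have "fiber_op \<phi> (scp_scale s a) x v = (\<lambda>i. s * fiber_op \<phi> a x v i)"
    by (rule ext) (rule fiber_op_scp_scale)
  then have "sqn N (fiber_op \<phi> (scp_scale s a) x v) = (cmod s)\<^sup>2 * sqn N (fiber_op \<phi> a x v)"
    by (simp only: sqn_scale)
  also have "\<dots> \<le> (cmod s)\<^sup>2 * (c\<^sup>2 * sqn N v)"
    by (intro mult_left_mono op_boundD[OF assms x]) simp
  finally show "sqn N (fiber_op \<phi> (scp_scale s a) x v) \<le> (cmod s * c)\<^sup>2 * sqn N v"
    by (simp add: power_mult_distrib)
qed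

lemma op_bound_zero: "op_bound X \<phi> 0 0"
  by (simp add: op_bound_def fiber_op_def sqn_def)

lemma uminus_eq_scp_scale: "- a = scp_scale (-1) a"
  by (simp add: scp_scale_def fun_eq_iff)

lemma op_bound_uminus: "op_bound X \<phi> a c \<Longrightarrow> op_bound X \<phi> (- a) c"
  using op_bound_scale[of X \<phi> a c "-1"] by (simp add: uminus_eq_scp_scale)

lemma op_bound_diff: "op_bound X \<phi> a c \<Longrightarrow> op_bound X \<phi> b d \<Longrightarrow> op_bound X \<phi> (a - b) (c + d)"
  using op_bound_add[of X \<phi> a c "- b" d] op_bound_uminus[of X \<phi> b d] by simp

text \<open>Apply the fibre operator to the first basis vector: coordinate \<open>n\<close> of the
  image is \<open>a n x\<close>. This is the contractivity of the Fourier coefficient maps.\<close>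

lemma op_bound_coeff:
  assumes "op_bound X \<phi> a c" "x \<in> topspace X"
  shows "cmod (a n x) \<le> c"
proof -
  let ?v = "\<lambda>i::nat. if i = 0 then 1 else (0::complex)"
  have "fiber_op \<phi> a x ?v n = a n x"
    by (simp add: fiber_op_def if_distrib cong: if_cong)
  then have "(cmod (a n x))\<^sup>2 \<le> sqn (Suc n) (fiber_op \<phi> a x ?v)"
    using sqn_nonneg[of n "fiber_op \<phi> a x ?v"] by (simp add: sqn_def)
  also have "\<dots> \<le> c\<^sup>2 * sqn (Suc n) ?v" by (rule op_boundD[OF assms])
  also have "sqn (Suc n) ?v = 1"
    unfolding sqn_def by (subst sum.lessThan_Suc_shift) simp
  finally show ?thesis using op_bound_nonneg[OF assms(1)] by (simp add: power2_le_iff_abs_le)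
qed

text \<open>The exponents \<open>i - j - m\<close> and \<open>j\<close> of \<open>\<phi>\<close> add
  up to \<open>i - m\<close>, which is the middle index \<open>k\<close> of the matrix product; what
  remains is an exchange of sums over \<open>j \<le> k \<le> i\<close>.\<close>

lemma fiber_op_mult:
  "fiber_op \<phi> (scp_mult \<phi> a b) x v i = fiber_op \<phi> a x (fiber_op \<phi> b x v) i"
proof -
  have "fiber_op \<phi> (scp_mult \<phi> a b) x v i =
    (\<Sum>j\<le>i. \<Sum>m\<le>i - j. a m ((\<phi> ^^ (i - m)) x) * b (i - j - m) ((\<phi> ^^ j) x) * v j)"
    unfolding fiber_op_def scp_mult_def sum_distrib_right
  proof (intro sum.cong refl)
    fix j m assume "j \<in> {..i}" "m \<in> {..i - j}"
    then have "(\<phi> ^^ (i - j - m)) ((\<phi> ^^ j) x) = (\<phi> ^^ (i - m)) x"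
      by (simp flip: funpow_add[THEN fun_cong, unfolded comp_apply])
    then show "a m ((\<phi> ^^ (i - j - m)) ((\<phi> ^^ j) x)) * b (i - j - m) ((\<phi> ^^ j) x) * v j =
       a m ((\<phi> ^^ (i - m)) x) * b (i - j - m) ((\<phi> ^^ j) x) * v j" by simp
  qed
  also have "\<dots> = (\<Sum>j\<le>i. \<Sum>k\<in>{j..i}. a (i - k) ((\<phi> ^^ k) x) * b (k - j) ((\<phi> ^^ j) x) * v j)"
  proof (rule sum.cong[OF refl])
    fix j assume j: "j \<in> {..i}"
    show "(\<Sum>m\<le>i - j. a m ((\<phi> ^^ (i - m)) x) * b (i - j - m) ((\<phi> ^^ j) x) * v j) =
      (\<Sum>k\<in>{j..i}. a (i - k) ((\<phi> ^^ k) x) * b (k - j) ((\<phi> ^^ j) x) * v j)"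
      by (rule sum.reindex_bij_witness[of _ "\<lambda>k. i - k" "\<lambda>m. i - m"])
        (use j in \<open>auto simp: add.commute\<close>)
  qed
  also have "\<dots> = (\<Sum>j\<in>{..i}. \<Sum>k\<in>{k \<in> {..i}. j \<le> k}. a (i - k) ((\<phi> ^^ k) x) * b (k - j) ((\<phi> ^^ j) x) * v j)"
    by (intro sum.cong) auto
  also have "\<dots> = (\<Sum>k\<in>{..i}. \<Sum>j\<in>{j \<in> {..i}. j \<le> k}. a (i - k) ((\<phi> ^^ k) x) * b (k - j) ((\<phi> ^^ j) x) * v j)"
    by (rule sum.swap_restrict) auto
  also have "\<dots> = (\<Sum>k\<le>i. \<Sum>j\<le>k. a (i - k) ((\<phi> ^^ k) x) * b (k - j) ((\<phi> ^^ j) x) * v j)"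
    by (intro sum.cong) auto
  finally show ?thesis by (simp add: fiber_op_def sum_distrib_left mult.assoc)
qed

lemma op_bound_mult:
  assumes "op_bound X \<phi> a c" "op_bound X \<phi> b d"
  shows "op_bound X \<phi> (scp_mult \<phi> a b) (c * d)"
  unfolding op_bound_def
proof (intro conjI ballI allI)
  show "0 \<le> c * d" using assms op_bound_nonneg by (meson mult_nonneg_nonneg)
  fix x v N assume x: "x \<in> topspace X"
  have "sqn N (fiber_op \<phi> (scp_mult \<phi> a b) x v) = sqn N (fiber_op \<phi> a x (fiber_op \<phi> b x v))"
    by (simp add: fiber_op_mult sqn_def)
  also have "\<dots> \<le> c\<^sup>2 * sqn N (fiber_op \<phi> b x v)" by (rule op_boundD[OF assms(1) x])
  also have "\<dots> \<le> c\<^sup>2 * (d\<^sup>2 * sqn N v)" by (intro mult_left_mono op_boundD[OF assms(2) x]) simp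
  finally show "sqn N (fiber_op \<phi> (scp_mult \<phi> a b) x v) \<le> (c * d)\<^sup>2 * sqn N v"
    by (simp add: power_mult_distrib)
qed

section \<open>Monomials \<open>U^n f\<close> and Fejer summation of Fourier series\<close>

section \<open>Monomials and Cesaro means\<close>

definition wmono :: "nat \<Rightarrow> ('a \<Rightarrow> complex) \<Rightarrow> nat \<Rightarrow> 'a \<Rightarrow> complex" where
  "wmono n f = (\<lambda>k. if k = n then f else 0)"

text \<open>Fejer means: truncated subtraction makes the weights vanish from degree \<open>N\<close>
  on, and \<open>N = 0\<close> gives the zero element since division by zero is zero.\<close>

definition cesaro :: "nat \<Rightarrow> (nat \<Rightarrow> 'a \<Rightarrow> complex) \<Rightarrow> nat \<Rightarrow> 'a \<Rightarrow> complex" where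
  "cesaro N a = (\<lambda>n x. of_real (real (N - n) / real N) * a n x)"

lemma wmono_same [simp]: "wmono n f n = f"
  by (simp add: wmono_def)

lemma wmono_apply: "wmono n f k x = (if k = n then f x else 0)"
  by (simp add: wmono_def)

lemma scp_mult_wmono_left:
  "scp_mult \<phi> (wmono n f) b k x = (if n \<le> k then f ((\<phi> ^^ (k - n)) x) * b (k - n) x else 0)"
proof -
  have "scp_mult \<phi> (wmono n f) b k x = (\<Sum>m\<le>k. if m = n then f ((\<phi> ^^ (k - n)) x) * b (k - n) x else 0)"
    unfolding scp_mult_def by (intro sum.cong) (auto simp: wmono_apply)
  then show ?thesis by simp
qed

lemma scp_mult_wmono_right:
  "scp_mult \<phi> a (wmono n f) k x = (if n \<le> k then a (k - n) ((\<phi> ^^ n) x) * f x else 0)"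
proof -
  have "scp_mult \<phi> a (wmono n f) k x = (\<Sum>m\<le>k. if m = k - n then (if n \<le> k then a (k - n) ((\<phi> ^^ n) x) * f x else 0) else 0)"
    unfolding scp_mult_def by (intro sum.cong) (auto simp: wmono_apply)
  then show ?thesis by simp
qed

text \<open>On each fibre the operator is a weighted shift with weights
  \<open>f ((\<phi> ^^ j) x)\<close>.\<close>

lemma op_bound_wmono:
  assumes "0 \<le> c" "\<And>x. x \<in> topspace X \<Longrightarrow> cmod (f x) \<le> c" "\<phi> ` topspace X \<subseteq> topspace X"
  shows "op_bound X \<phi> (wmono n f) c"
  unfolding op_bound_def
proof (intro conjI ballI allI assms(1))
  fix x v N assume x: "x \<in> topspace X"
  have orb: "(\<phi> ^^ k) x \<in> topspace X" for k
    using x assms(3) by (induction k) auto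
  have eq: "fiber_op \<phi> (wmono n f) x v i = (if n \<le> i then f ((\<phi> ^^ (i - n)) x) * v (i - n) else 0)" for i
  proof -
    have "fiber_op \<phi> (wmono n f) x v i = (\<Sum>j\<le>i. if j = i - n then (if n \<le> i then f ((\<phi> ^^ (i - n)) x) * v (i - n) else 0) else 0)"
      unfolding fiber_op_def by (intro sum.cong) (auto simp: wmono_apply)
    then show ?thesis by simp
  qed
  have "sqn N (fiber_op \<phi> (wmono n f) x v) = (\<Sum>i\<in>{n..<N}. (cmod (f ((\<phi> ^^ (i - n)) x) * v (i - n)))\<^sup>2)"
    unfolding sqn_def by (rule sum.mono_neutral_cong_right) (auto simp: eq)
  also have "\<dots> = (\<Sum>j<N - n. (cmod (f ((\<phi> ^^ j) x) * v j))\<^sup>2)"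
    by (rule sum.reindex_bij_witness[of _ "\<lambda>j. j + n" "\<lambda>i. i - n"]) auto
  also have "\<dots> \<le> (\<Sum>j<N - n. c\<^sup>2 * (cmod (v j))\<^sup>2)"
    unfolding norm_mult power_mult_distrib
    by (intro sum_mono mult_right_mono power_mono assms orb) auto
  also have "\<dots> \<le> (\<Sum>j<N. c\<^sup>2 * (cmod (v j))\<^sup>2)"
    by (intro sum_mono2) auto
  finally show "sqn N (fiber_op \<phi> (wmono n f) x v) \<le> c\<^sup>2 * sqn N v"
    by (simp add: sqn_def sum_distrib_left)
qed

lemma sum_wmono_apply:
  "finite A \<Longrightarrow> (\<Sum>n\<in>A. wmono n (f n)) k x = (if k \<in> A then f k x else 0)"
  by (induction A rule: finite_induct) (auto simp: wmono_apply)

lemma poly_eq_sum_wmono: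
  assumes "\<And>n. N \<le> n \<Longrightarrow> p n = 0"
  shows "p = (\<Sum>n<N. wmono n (p n))"
  using assms by (auto simp: fun_eq_iff sum_wmono_apply not_less)

lemma op_bound_sum:
  "finite A \<Longrightarrow> (\<And>n. n \<in> A \<Longrightarrow> op_bound X \<phi> (f n) (c n)) \<Longrightarrow> op_bound X \<phi> (sum f A) (sum c A)"
  by (induction A rule: finite_induct) (auto intro: op_bound_zero op_bound_add)

text \<open>The Fejer kernel \<open>max 0 (1 - \<bar>i - j\<bar> / N)\<close> is \<open>1 / N\<close> times the sum of the rank-one
  kernels given by the indicators of the windows \<open>{k - N<..k}\<close>, and every index lies in
  exactly \<open>N\<close> windows.\<close>

lemma op_bound_cesaro:
  assumes a: "op_bound X \<phi> a c" and N: "0 < N"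
  shows "op_bound X \<phi> (cesaro N a) c"
proof (rule op_boundI_form)
  show "0 \<le> c" by (rule op_bound_nonneg[OF a])
  fix x M u v assume x: "x \<in> topspace X"
  define r where "r k w i = (if i \<le> k \<and> k < i + N then w i else 0)" for k i :: nat and w :: "nat \<Rightarrow> complex"
  \<comment> \<open>Windows are indexed by their right end \<open>k\<close>; \<open>M + N\<close> of
    them contain all windows through indices below \<open>M\<close>. The indices \<open>i\<close>
    and \<open>j\<close> share \<open>N - (i - j)\<close> windows, none if they are \<open>N\<close>
    or more apart.\<close>
  have win: "(\<Sum>k<M + N. if j \<le> k \<and> k < j + N \<and> i \<le> k \<and> k < i + N then z else 0) = of_nat (N - (i - j)) * z"
    if "j \<le> i" "i < M" for i j and z :: "'z :: comm_semiring_1"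
  proof -
    have "(\<Sum>k<M + N. if j \<le> k \<and> k < j + N \<and> i \<le> k \<and> k < i + N then z else 0) = (\<Sum>k\<in>{i..<j + N}. z)"
      using that by (intro sum.mono_neutral_cong_right) auto
    also have "\<dots> = of_nat (N - (i - j)) * z" using that by (simp add: add.commute)
    finally show ?thesis .
  qed
  have sq: "(\<Sum>k<M + N. sqn M (r k w)) = real N * sqn M w" for w
  proof -
    have "(\<Sum>k<M + N. sqn M (r k w)) = (\<Sum>i<M. \<Sum>k<M + N. if i \<le> k \<and> k < i + N \<and> i \<le> k \<and> k < i + N then (cmod (w i))\<^sup>2 else 0)"
      unfolding sqn_def r_def by (subst sum.swap) (auto intro!: sum.cong)
    also have "\<dots> = (\<Sum>i<M. real N * (cmod (w i))\<^sup>2)"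
      by (intro sum.cong refl, subst win) auto
    finally show ?thesis by (simp add: sqn_def sum_distrib_left)
  qed
  have "(\<Sum>k<M + N. fiber_form \<phi> a x M (r k u) (r k v)) =
    (\<Sum>i<M. \<Sum>j<M. \<Sum>k<M + N. cnj (r k u i) * (if j \<le> i then a (i - j) ((\<phi> ^^ j) x) else 0) * r k v j)"
    unfolding fiber_form_eq by (subst sum.swap, rule sum.cong[OF refl], rule sum.swap)
  also have "\<dots> = (\<Sum>i<M. \<Sum>j<M. of_nat N * (cnj (u i) * (if j \<le> i then cesaro N a (i - j) ((\<phi> ^^ j) x) else 0) * v j))"
  proof (intro sum.cong refl)
    fix i j assume ij: "i \<in> {..<M}" "j \<in> {..<M}"
    show "(\<Sum>k<M + N. cnj (r k u i) * (if j \<le> i then a (i - j) ((\<phi> ^^ j) x) else 0) * r k v j) =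
      of_nat N * (cnj (u i) * (if j \<le> i then cesaro N a (i - j) ((\<phi> ^^ j) x) else 0) * v j)"
    proof (cases "j \<le> i")
      case True
      have "(\<Sum>k<M + N. cnj (r k u i) * (if j \<le> i then a (i - j) ((\<phi> ^^ j) x) else 0) * r k v j) =
        (\<Sum>k<M + N. if j \<le> k \<and> k < j + N \<and> i \<le> k \<and> k < i + N then cnj (u i) * a (i - j) ((\<phi> ^^ j) x) * v j else 0)"
        using True by (intro sum.cong) (auto simp: r_def)
      also have "\<dots> = of_nat (N - (i - j)) * (cnj (u i) * a (i - j) ((\<phi> ^^ j) x) * v j)"
        using True ij by (intro win) auto
      finally show ?thesis using True N by (simp add: cesaro_def)
    qed simp
  qed
  also have "\<dots> = of_nat N * fiber_form \<phi> (cesaro N a) x M u v"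
    by (simp add: fiber_form_eq sum_distrib_left)
  finally have "real N * cmod (fiber_form \<phi> (cesaro N a) x M u v) = cmod (\<Sum>k<M + N. fiber_form \<phi> a x M (r k u) (r k v))"
    by (simp add: norm_mult)
  also have "\<dots> \<le> (\<Sum>k<M + N. c * (sqn M (r k u) + sqn M (r k v)) / 2)"
    by (intro sum_norm_le fiber_form_le[OF a x])
  also have "\<dots> = c * (real N * sqn M u + real N * sqn M v) / 2"
    by (simp add: sq[symmetric] flip: sum_divide_distrib sum_distrib_left sum.distrib)
  also have "\<dots> = real N * (c * (sqn M u + sqn M v) / 2)"
    by (simp add: algebra_simps)
  finally show "cmod (fiber_form \<phi> (cesaro N a) x M u v) \<le> c * (sqn M u + sqn M v) / 2"
    using N by simp
qed

lemma cesaro_diff: "cesaro N (a - b) = cesaro N a - cesaro N b"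
  by (simp add: cesaro_def fun_eq_iff right_diff_distrib del: of_real_divide)

text \<open>Being a finite combination of the monomials of \<open>a\<close>, a Cesaro mean lies in
  every ideal that contains these monomials.\<close>

lemma cesaro_eq_sum: "cesaro N a = (\<Sum>n<N. scp_scale (of_real (real (N - n) / real N)) (wmono n (a n)))"
proof -
  have "cesaro N a = (\<Sum>n<N. wmono n (cesaro N a n))"
    by (rule poly_eq_sum_wmono) (auto simp: cesaro_def fun_eq_iff)
  also have "\<dots> = (\<Sum>n<N. scp_scale (of_real (real (N - n) / real N)) (wmono n (a n)))"
    by (intro sum.cong) (auto simp: fun_eq_iff wmono_def scp_scale_def cesaro_def)
  finally show ?thesis .
qed

section \<open>Functions vanishing at infinity\<close>

definition C0_on :: "'a topology \<Rightarrow> 'a set \<Rightarrow> ('a \<Rightarrow> complex) set" where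
  "C0_on X G = {f \<in> C0 X. \<forall>x. x \<notin> G \<longrightarrow> f x = 0}"

lemma C0_onD: "f \<in> C0_on X G \<Longrightarrow> f \<in> C0 X" "f \<in> C0_on X G \<Longrightarrow> x \<notin> G \<Longrightarrow> f x = 0"
  by (auto simp: C0_on_def)

lemma C0D:
  assumes "f \<in> C0 X"
  shows "continuous_map X euclidean f" "x \<notin> topspace X \<Longrightarrow> f x = 0"
    "0 < e \<Longrightarrow> \<exists>K. compactin X K \<and> (\<forall>x\<in>topspace X - K. cmod (f x) < e)"
  using assms by (auto simp: C0_def)

lemma continuous_map_complex_mult:
  assumes "continuous_map X euclidean f" "continuous_map X euclidean (g :: 'a \<Rightarrow> complex)"
  shows "continuous_map X euclidean (\<lambda>x. f x * g x)"
proof -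
  have "continuous_on UNIV (\<lambda>p::complex \<times> complex. fst p * snd p)"
    by (intro continuous_intros)
  then have "continuous_map euclidean euclidean (\<lambda>p::complex \<times> complex. fst p * snd p)"
    by simp
  moreover have "continuous_map X euclidean (\<lambda>x. (f x, g x))"
    using continuous_map_pairedI[OF assms] by (simp add: prod_topology_euclidean)
  ultimately show ?thesis
    using continuous_map_compose[of X euclidean "\<lambda>x. (f x, g x)" euclidean "\<lambda>p. fst p * snd p"]
    by (simp add: o_def)
qed

lemma continuous_map_of_real:
  assumes "continuous_map X euclideanreal f"
  shows "continuous_map X euclidean (\<lambda>x. of_real (f x) :: complex)"
proof -
  have "continuous_map euclideanreal euclidean (of_real :: real \<Rightarrow> complex)"
    by (simp add: continuous_on_of_real_id)
  from continuous_map_compose[OF assms this] show ?thesis by (simp add: o_def)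
qed

lemma C0_zero: "0 \<in> C0 X"
  by (auto simp: C0_def zero_fun_def)

lemma C0_bounded:
  assumes "f \<in> C0 X"
  obtains c where "0 < c" "\<And>x. cmod (f x) \<le> c"
proof -
  obtain K where K: "compactin X K" "\<forall>x\<in>topspace X - K. cmod (f x) < 1"
    using C0D(3)[OF assms, of 1] by auto
  have "compactin euclidean (f ` K)"
    using image_compactin[OF K(1) C0D(1)[OF assms]] .
  then obtain b where b: "\<And>x. x \<in> K \<Longrightarrow> cmod (f x) \<le> b"
    by (metis compact_imp_bounded compactin_euclidean_iff bounded_iff imageI)
  have "cmod (f x) \<le> max 1 b" for x
    using K(2) b[of x] C0D(2)[OF assms, of x] by (cases "x \<in> topspace X"; cases "x \<in> K") (auto intro: less_imp_le le_max_iff_disj[THEN iffD2])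
  then show ?thesis by (intro that[of "max 1 b"]) auto
qed

lemma C0_mult_bounded:
  assumes f: "f \<in> C0 X" and g: "continuous_map X euclidean g" and b: "\<And>x. x \<in> topspace X \<Longrightarrow> cmod (g x) \<le> b"
  shows "(\<lambda>x. f x * g x) \<in> C0 X"
  unfolding C0_def
proof (intro CollectI conjI allI impI)
  show "continuous_map X euclidean (\<lambda>x. f x * g x)"
    by (rule continuous_map_complex_mult[OF C0D(1)[OF f] g])
  show "f x * g x = 0" if "x \<notin> topspace X" for x
    using C0D(2)[OF f that] by simp
  fix e :: real assume "0 < e"
  define c where "c = \<bar>b\<bar> + 1"
  obtain K where K: "compactin X K" "\<forall>x\<in>topspace X - K. cmod (f x) < e / c"
    using C0D(3)[OF f, of "e / c"] \<open>0 < e\<close> by (auto simp: c_def)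
  have "cmod (f x * g x) < e" if x: "x \<in> topspace X - K" for x
  proof -
    have "cmod (g x) \<le> c" using b[of x] x by (auto simp: c_def)
    then have "cmod (f x * g x) \<le> cmod (f x) * c"
      by (simp add: norm_mult mult_left_mono)
    also have "\<dots> < e" using K(2) x by (simp add: c_def field_simps)
    finally show ?thesis .
  qed
  then show "\<exists>K. compactin X K \<and> (\<forall>x\<in>topspace X - K. cmod (f x * g x) < e)"
    using K(1) by blast
qed

lemma C0_mult: "f \<in> C0 X \<Longrightarrow> g \<in> C0 X \<Longrightarrow> (\<lambda>x. f x * g x) \<in> C0 X"
  by (metis C0_mult_bounded C0D(1) C0_bounded)

lemma C0_add:
  assumes f: "f \<in> C0 X" and g: "g \<in> C0 X"
  shows "f + g \<in> C0 X"
  unfolding C0_def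
proof (intro CollectI conjI allI impI)
  show "continuous_map X euclidean (f + g)"
    using continuous_map_add[OF C0D(1)[OF f] C0D(1)[OF g]] by (simp add: plus_fun_def)
  show "(f + g) x = 0" if "x \<notin> topspace X" for x
    using C0D(2)[OF f that] C0D(2)[OF g that] by simp
  fix e :: real assume e: "0 < e"
  obtain K where K: "compactin X K" "\<forall>x\<in>topspace X - K. cmod (f x) < e / 2"
    using C0D(3)[OF f, of "e / 2"] e by auto
  obtain L where L: "compactin X L" "\<forall>x\<in>topspace X - L. cmod (g x) < e / 2"
    using C0D(3)[OF g, of "e / 2"] e by auto
  have "cmod ((f + g) x) < e" if "x \<in> topspace X - (K \<union> L)" for x
  proof -
    have "cmod (f x) < e / 2" "cmod (g x) < e / 2" using K L that by auto
    then show ?thesis using norm_triangle_ineq[of "f x" "g x"] by simp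
  qed
  then show "\<exists>K. compactin X K \<and> (\<forall>x\<in>topspace X - K. cmod ((f + g) x) < e)"
    using compactin_Un[OF K(1) L(1)] by blast
qed

lemma C0_scale: "f \<in> C0 X \<Longrightarrow> (\<lambda>x. c * f x) \<in> C0 X"
  using C0_mult_bounded[of f X "\<lambda>_. c" "cmod c"] by (simp add: mult.commute)

lemma C0_sum: "(\<And>i. i \<in> A \<Longrightarrow> f i \<in> C0 X) \<Longrightarrow> (\<lambda>x. \<Sum>i\<in>A. f i x) \<in> C0 X"
proof (induction A rule: infinite_finite_induct)
  case (insert i A)
  then show ?case using C0_add[of "f i" X "\<lambda>x. \<Sum>i\<in>A. f i x"] by (simp add: plus_fun_def)
qed (use C0_zero[of X] in \<open>simp_all add: zero_fun_def\<close>)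

text \<open>The composed factor contributes continuity and boundedness; the decay at infinity comes
  from \<open>g\<close>.\<close>

lemma C0_comp_mult:
  assumes f: "f \<in> C0 X" and g: "g \<in> C0 X" and \<psi>: "continuous_map X X \<psi>"
  shows "(\<lambda>x. f (\<psi> x) * g x) \<in> C0 X"
proof -
  have "continuous_map X euclidean (\<lambda>x. f (\<psi> x))"
    using continuous_map_compose[OF \<psi> C0D(1)[OF f]] by (simp add: o_def)
  moreover obtain c where "\<And>x. cmod (f x) \<le> c"
    using C0_bounded[OF f] by blast
  ultimately show ?thesis
    using C0_mult_bounded[OF g, of "\<lambda>x. f (\<psi> x)" c] by (simp add: mult.commute)
qed

section \<open>The semicrossed product as a normed algebra, quotient norms, and membership in closed
  ideals\<close>

section \<open>The algebra and its quotients\<close>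

lemma scp_mult_diff_left: "scp_mult \<phi> (a - b) c = scp_mult \<phi> a c - scp_mult \<phi> b c"
  by (simp add: scp_mult_def fun_eq_iff left_diff_distrib sum_subtractf)

lemma scp_mult_diff_right: "scp_mult \<phi> a (b - c) = scp_mult \<phi> a b - scp_mult \<phi> a c"
  by (simp add: scp_mult_def fun_eq_iff right_diff_distrib sum_subtractf)

lemma is_idealD:
  assumes "is_ideal B mul sc J"
  shows "J \<subseteq> B" "0 \<in> J" "x \<in> J \<Longrightarrow> y \<in> J \<Longrightarrow> x + y \<in> J" "x \<in> J \<Longrightarrow> - x \<in> J"
    "x \<in> J \<Longrightarrow> sc c x \<in> J" "b \<in> B \<Longrightarrow> x \<in> J \<Longrightarrow> mul b x \<in> J" "b \<in> B \<Longrightarrow> x \<in> J \<Longrightarrow> mul x b \<in> J"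
  using assms by (auto simp: is_ideal_def)

lemma is_ideal_diff:
  assumes "is_ideal B mul sc J" "x \<in> J" "y \<in> J"
  shows "x - y \<in> J"
  using is_idealD(3)[OF assms(1,2) is_idealD(4)[OF assms(1,3)]] by simp

lemma is_ideal_sum:
  assumes "is_ideal B mul sc J" "\<And>i. i \<in> A \<Longrightarrow> f i \<in> J"
  shows "sum f A \<in> J"
  using assms(2) by (induction A rule: infinite_finite_induct) (auto intro: is_idealD[OF assms(1)])

locale semicrossed_system =
  fixes X :: "'a topology" and \<phi> :: "'a \<Rightarrow> 'a"
  assumes metrizable: "metrizable_space X"
    and locally_compact: "locally_compact_space X"
    and cont: "continuous_map X X \<phi>"
begin

abbreviation "\<A> \<equiv> semicrossed X \<phi>"
abbreviation "nrm \<equiv> scp_norm X \<phi>"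
abbreviation "bdd \<equiv> op_bound X \<phi>"
abbreviation mult (infixl "\<bullet>\<^sub>\<phi>" 70) where "mult \<equiv> scp_mult \<phi>"

lemma cont_funpow: "continuous_map X X (\<phi> ^^ k)"
proof (induction k)
  case (Suc k)
  show ?case using continuous_map_compose[OF Suc cont] by (simp only: funpow.simps(2))
qed simp

lemma orbit_in: "x \<in> topspace X \<Longrightarrow> (\<phi> ^^ k) x \<in> topspace X"
  using continuous_map_image_subset_topspace[OF cont_funpow[of k]] by auto

lemma bdd_wmono:
  assumes "0 \<le> c" "\<And>x. cmod (f x) \<le> c"
  shows "bdd (wmono n f) c"
  using assms continuous_map_image_subset_topspace[OF cont] by (intro op_bound_wmono) auto

lemma bdd_poly:
  assumes "\<And>n. p n \<in> C0 X" "\<And>n. N \<le> n \<Longrightarrow> p n = 0"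
  shows "\<exists>c. bdd p c"
proof -
  have "\<exists>c. bdd (wmono n (p n)) c" for n
    using C0_bounded[OF assms(1)[of n]] bdd_wmono by (metis less_imp_le)
  then obtain c where "\<And>n. bdd (wmono n (p n)) (c n)" by metis
  then have "bdd (\<Sum>n<N. wmono n (p n)) (\<Sum>n<N. c n)"
    by (intro op_bound_sum) auto
  then have "bdd p (\<Sum>n<N. c n)"
    by (simp only: poly_eq_sum_wmono[of N p, OF assms(2), symmetric])
  then show ?thesis ..
qed

text \<open>Replaces the approximating sequence by one polynomial per tolerance and the bilinear
  forms by \<open>bdd\<close>. Conversely, approximants with error \<open>1 / Suc m\<close> form
  such a sequence.\<close>

lemma in_semicrossed_iff:
  "a \<in> \<A> \<longleftrightarrow> (\<forall>n. a n \<in> C0 X) \<and>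
    (\<forall>e>0. \<exists>p N. (\<forall>n. p n \<in> C0 X) \<and> (\<forall>n\<ge>N. p n = 0) \<and> bdd (a - p) e)" (is "_ \<longleftrightarrow> _ \<and> ?R")
proof (intro iffI conjI)
  assume a: "a \<in> \<A>"
  then show "\<forall>n. a n \<in> C0 X" by (simp add: semicrossed_def)
  show ?R
  proof (intro allI impI)
    fix e :: real assume e: "0 < e"
    from a obtain p :: "nat \<Rightarrow> nat \<Rightarrow> 'a \<Rightarrow> complex" where p: "\<forall>m n. p m n \<in> C0 X" "\<forall>m. \<exists>N. \<forall>n\<ge>N. p m n = 0"
        "\<forall>e>0. \<exists>M. \<forall>m\<ge>M. \<forall>S u v. admissible X S u v \<longrightarrow> cmod (scp_bil \<phi> (a - p m) S u v) \<le> e"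
      unfolding semicrossed_def mem_Collect_eq by (elim conjE exE) (rule that, assumption+)
    from p(3)[rule_format, OF e] obtain M where "\<And>S u v. admissible X S u v \<Longrightarrow> cmod (scp_bil \<phi> (a - p M) S u v) \<le> e"
      by blast
    then have "bdd (a - p M) e" using e by (intro op_boundI_bil) auto
    with p(1,2) show "\<exists>p N. (\<forall>n. p n \<in> C0 X) \<and> (\<forall>n\<ge>N. p n = 0) \<and> bdd (a - p) e"
      by blast
  qed
next
  assume R: "(\<forall>n. a n \<in> C0 X) \<and> ?R"
  then have "\<forall>m::nat. \<exists>p. \<exists>N. (\<forall>n. p n \<in> C0 X) \<and> (\<forall>n\<ge>N. p n = 0) \<and> bdd (a - p) (1 / Suc m)"
    by simp
  then obtain p where p: "\<And>m. \<exists>N. (\<forall>n. p m n \<in> C0 X) \<and> (\<forall>n\<ge>N. p m n = 0) \<and> bdd (a - p m) (1 / Suc m)"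
    by metis
  have "\<exists>M. \<forall>m\<ge>M. \<forall>S u v. admissible X S u v \<longrightarrow> cmod (scp_bil \<phi> (a - p m) S u v) \<le> e" if e: "0 < e" for e
  proof -
    obtain M where M: "1 / real (Suc M) < e"
      using reals_Archimedean[OF e] by (auto simp: inverse_eq_divide)
    have "cmod (scp_bil \<phi> (a - p m) S u v) \<le> e" if "M \<le> m" "admissible X S u v" for m S u v
    proof -
      have "cmod (scp_bil \<phi> (a - p m) S u v) \<le> 1 / Suc m"
        using p that(2) scp_bil_le by blast
      also have "\<dots> \<le> 1 / Suc M" using that(1) by (simp add: frac_le)
      finally show ?thesis using M by simp
    qed
    then show ?thesis by blast
  qed
  moreover have "\<forall>m n. p m n \<in> C0 X" "\<forall>m. \<exists>N. \<forall>n\<ge>N. p m n = 0" using p by blast+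
  ultimately show "a \<in> \<A>"
    unfolding semicrossed_def using R by (intro CollectI conjI exI[of _ p]) simp_all
qed

lemma coeff_C0: "a \<in> \<A> \<Longrightarrow> a n \<in> C0 X"
  by (simp add: semicrossed_def)

lemma poly_approx:
  assumes "a \<in> \<A>" "0 < e"
  obtains p N where "\<And>n. p n \<in> C0 X" "\<And>n. N \<le> n \<Longrightarrow> p n = 0" "bdd (a - p) e"
  using assms in_semicrossed_iff by blast

lemma poly_in_semicrossed:
  assumes "\<And>n. p n \<in> C0 X" "\<And>n. N \<le> n \<Longrightarrow> p n = 0"
  shows "p \<in> \<A>"
  unfolding in_semicrossed_iff
proof (intro conjI allI impI exI[of _ p] exI[of _ N])
  fix e :: real assume "0 < e"
  then show "bdd (p - p) e" using op_bound_mono[OF op_bound_zero, of e X \<phi>] by simp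
qed (use assms in auto)

lemma semicrossed_bdd:
  assumes "a \<in> \<A>"
  shows "\<exists>c. bdd a c"
proof -
  obtain p N where p: "\<And>n. p n \<in> C0 X" "\<And>n. N \<le> n \<Longrightarrow> p n = 0" "bdd (a - p) 1"
    using poly_approx[OF assms, of 1] by auto
  obtain c where "bdd p c" using bdd_poly[of p N, OF p(1,2)] by auto
  from op_bound_add[OF p(3) this] show ?thesis by auto
qed

lemma bdd_nrm: "a \<in> \<A> \<Longrightarrow> bdd a (nrm a)"
  using semicrossed_bdd op_bound_scp_norm by blast

lemma nrm_nonneg: "a \<in> \<A> \<Longrightarrow> 0 \<le> nrm a"
  using bdd_nrm op_bound_nonneg by blast

lemma coeff_le_nrm:
  assumes "a \<in> \<A>"
  shows "cmod (a n x) \<le> nrm a"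
  using op_bound_coeff[OF bdd_nrm[OF assms], of x n] nrm_nonneg[OF assms] C0D(2)[OF coeff_C0[OF assms], of x n]
  by (cases "x \<in> topspace X") auto

lemma wmono_in: "f \<in> C0 X \<Longrightarrow> wmono n f \<in> \<A>"
  by (rule poly_in_semicrossed[of _ "Suc n"]) (auto simp: wmono_def C0_zero)

lemma zero_in: "0 \<in> \<A>"
  by (rule poly_in_semicrossed[of _ 0]) (auto simp: C0_zero)

lemma add_in:
  assumes "a \<in> \<A>" "b \<in> \<A>"
  shows "a + b \<in> \<A>"
  unfolding in_semicrossed_iff
proof (intro conjI allI impI)
  show "(a + b) n \<in> C0 X" for n
    using C0_add[OF coeff_C0[OF assms(1)] coeff_C0[OF assms(2)]] by simp
  fix e :: real assume e: "0 < e"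
  obtain p N where p: "\<And>n. p n \<in> C0 X" "\<And>n. N \<le> n \<Longrightarrow> p n = 0" "bdd (a - p) (e / 2)"
    using poly_approx[OF assms(1), of "e / 2"] e by auto
  obtain q M where q: "\<And>n. q n \<in> C0 X" "\<And>n. M \<le> n \<Longrightarrow> q n = 0" "bdd (b - q) (e / 2)"
    using poly_approx[OF assms(2), of "e / 2"] e by auto
  have eq: "(a - p) + (b - q) = a + b - (p + q)" by simp
  have "bdd (a + b - (p + q)) e"
    using op_bound_add[OF p(3) q(3)] by (simp only: eq field_sum_of_halves)
  moreover have "(p + q) n \<in> C0 X" for n
    using C0_add[OF p(1)[of n] q(1)[of n]] by simp
  moreover have "(p + q) n = 0" if "max N M \<le> n" for n using p(2) q(2) that by simp
  ultimately show "\<exists>p N. (\<forall>n. p n \<in> C0 X) \<and> (\<forall>n\<ge>N. p n = 0) \<and> bdd (a + b - p) e"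
    by blast
qed

lemma mult_in:
  assumes "a \<in> \<A>" "b \<in> \<A>"
  shows "a \<bullet>\<^sub>\<phi> b \<in> \<A>"
proof -
  have C: "(p \<bullet>\<^sub>\<phi> q) n \<in> C0 X" if "\<And>n. p n \<in> C0 X" "\<And>n. q n \<in> C0 X" for p q n
    unfolding scp_mult_def using that by (intro C0_sum C0_comp_mult cont_funpow)
  show ?thesis
    unfolding in_semicrossed_iff
  proof (intro conjI allI impI)
    show "(a \<bullet>\<^sub>\<phi> b) n \<in> C0 X" for n
      by (intro C coeff_C0 assms)
    fix e :: real assume e: "0 < e"
    \<comment> \<open>With \<open>a b - p q = a (b - q) + (a - p) q\<close> the error is at most
      \<open>d (nrm a + nrm b + d)\<close>; \<open>d \<le> 1\<close> turns the last summand into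
      1.\<close>
    define d where "d = min 1 (e / (nrm a + nrm b + 1))"
    have pos: "0 < nrm a + nrm b + 1" using nrm_nonneg[OF assms(1)] nrm_nonneg[OF assms(2)] by simp
    have "d \<le> e / (nrm a + nrm b + 1)" by (simp add: d_def)
    then have d: "0 < d" "d \<le> 1" "d * (nrm a + nrm b + 1) \<le> e"
      using e pos by (simp add: d_def, simp add: d_def, simp only: pos_le_divide_eq[OF pos])
    obtain p N where p: "\<And>n. p n \<in> C0 X" "\<And>n. N \<le> n \<Longrightarrow> p n = 0" "bdd (a - p) d"
      using poly_approx[OF assms(1) d(1)] by blast
    obtain q M where q: "\<And>n. q n \<in> C0 X" "\<And>n. M \<le> n \<Longrightarrow> q n = 0" "bdd (b - q) d"
      using poly_approx[OF assms(2) d(1)] by blast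
    have "bdd (b - (b - q)) (nrm b + d)"
      by (rule op_bound_diff[OF bdd_nrm[OF assms(2)] q(3)])
    then have qb: "bdd q (nrm b + d)" by simp
    have "a \<bullet>\<^sub>\<phi> b - p \<bullet>\<^sub>\<phi> q = a \<bullet>\<^sub>\<phi> (b - q) + (a - p) \<bullet>\<^sub>\<phi> q"
      by (simp add: scp_mult_diff_left scp_mult_diff_right)
    moreover have "bdd (a \<bullet>\<^sub>\<phi> (b - q) + (a - p) \<bullet>\<^sub>\<phi> q) (nrm a * d + d * (nrm b + d))"
      by (intro op_bound_add op_bound_mult bdd_nrm assms p(3) q(3) qb)
    moreover have "nrm a * d + d * (nrm b + d) \<le> e"
    proof -
      have "d * d \<le> d * 1" using d by (intro mult_left_mono) auto
      then show ?thesis using d(3) by (simp add: algebra_simps)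
    qed
    ultimately have bdd: "bdd (a \<bullet>\<^sub>\<phi> b - p \<bullet>\<^sub>\<phi> q) e" using op_bound_mono by metis
    have zero: "(p \<bullet>\<^sub>\<phi> q) n = 0" if n: "N + M \<le> n" for n
    proof (rule ext)
      fix x
      have "p m ((\<phi> ^^ (n - m)) x) * q (n - m) x = 0" for m
        using p(2)[of m] q(2)[of "n - m"] n by (cases "N \<le> m") auto
      then show "(p \<bullet>\<^sub>\<phi> q) n x = 0 x"
        unfolding scp_mult_def by (simp add: sum.neutral del: mult_eq_0_iff)
    qed
    show "\<exists>p N. (\<forall>n. p n \<in> C0 X) \<and> (\<forall>n\<ge>N. p n = 0) \<and> bdd (a \<bullet>\<^sub>\<phi> b - p) e"
      by (intro exI[of _ "p \<bullet>\<^sub>\<phi> q"] exI[of _ "N + M"] conjI allI impI C p(1) q(1) zero bdd)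
  qed
qed

lemma scale_in:
  assumes "a \<in> \<A>"
  shows "scp_scale c a \<in> \<A>"
  unfolding in_semicrossed_iff
proof (intro conjI allI impI)
  show "scp_scale c a n \<in> C0 X" for n
    using C0_scale[OF coeff_C0[OF assms]] by (simp add: scp_scale_def)
  fix e :: real assume e: "0 < e"
  define d where "d = e / (cmod c + 1)"
  have c1: "0 < cmod c + 1" by (rule add_nonneg_pos) auto
  then have d: "0 < d" using e by (simp add: d_def)
  have "cmod c * d \<le> (cmod c + 1) * d" using d by simp
  also have "\<dots> = e" using c1 by (simp add: d_def)
  finally have cd: "cmod c * d \<le> e" .
  obtain p N where p: "\<And>n. p n \<in> C0 X" "\<And>n. N \<le> n \<Longrightarrow> p n = 0" "bdd (a - p) d"
    using poly_approx[OF assms d] by blast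
  have "scp_scale c (a - p) = scp_scale c a - scp_scale c p"
    by (simp add: scp_scale_def fun_eq_iff right_diff_distrib)
  then have "bdd (scp_scale c a - scp_scale c p) e"
    using op_bound_mono[OF op_bound_scale[OF p(3)] cd] by simp
  moreover have "scp_scale c p n \<in> C0 X" for n using C0_scale[OF p(1)] by (simp add: scp_scale_def)
  moreover have "scp_scale c p n = 0" if "N \<le> n" for n
    using p(2)[OF that] by (simp add: scp_scale_def fun_eq_iff)
  ultimately show "\<exists>p N. (\<forall>n. p n \<in> C0 X) \<and> (\<forall>n\<ge>N. p n = 0) \<and> bdd (scp_scale c a - p) e"
    by blast
qed

lemma uminus_in: "a \<in> \<A> \<Longrightarrow> - a \<in> \<A>"
  unfolding uminus_eq_scp_scale by (rule scale_in)

lemma diff_in: "a \<in> \<A> \<Longrightarrow> b \<in> \<A> \<Longrightarrow> a - b \<in> \<A>"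
  using add_in[of a "- b"] uminus_in[of b] by simp

text \<open>Beyond the degree of an approximating polynomial \<open>p\<close>, the coefficients of
  \<open>a\<close> are those of \<open>a - p\<close>.\<close>

lemma coeff_decay:
  assumes "a \<in> \<A>" "0 < e"
  obtains N where "\<And>n x. N \<le> n \<Longrightarrow> cmod (a n x) \<le> e"
proof -
  obtain p N where p: "\<And>n. p n \<in> C0 X" "\<And>n. N \<le> n \<Longrightarrow> p n = 0" "bdd (a - p) e"
    using poly_approx[OF assms] by blast
  have "cmod (a n x) \<le> e" if "N \<le> n" for n x
    using op_bound_coeff[OF p(3), of x n] p(2)[OF that] C0D(2)[OF coeff_C0[OF assms(1)], of x n] assms(2)
    by (cases "x \<in> topspace X") auto
  then show ?thesis by (rule that)
qed

text \<open>Fejer means do not increase bounds, so it suffices to treat a polynomial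
  \<open>p\<close> near \<open>a\<close>. There the degree \<open>n\<close> part of
  \<open>p - cesaro N p\<close> carries the factor \<open>n / N\<close>.\<close>

lemma cesaro_tendsto:
  assumes "a \<in> \<A>"
  shows "(\<lambda>N. nrm (cesaro N a - a)) \<longlonglongrightarrow> 0"
proof (rule LIMSEQ_I)
  fix e :: real assume e: "0 < e"
  obtain p D where p: "\<And>n. p n \<in> C0 X" "\<And>n. D \<le> n \<Longrightarrow> p n = 0" "bdd (a - p) (e / 4)"
    using poly_approx[OF assms, of "e / 4"] e by auto
  have "\<exists>c. bdd (wmono n (p n)) c" for n
    using C0_bounded[OF p(1)[of n]] bdd_wmono by (metis less_imp_le)
  then obtain c where c: "\<And>n. bdd (wmono n (p n)) (c n)" by metis
  \<comment> \<open>The error for \<open>p\<close> is at most \<open>s / N\<close>. The threshold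
    \<open>N0\<close> makes this at most \<open>e / 4\<close> and exceeds \<open>D\<close>, so that
    \<open>N - n\<close> is an exact difference for \<open>n < D\<close>.\<close>
  define s where "s = (\<Sum>n<D. real n * c n)"
  define N0 where "N0 = Suc (D + nat \<lceil>s * 4 / e\<rceil>)"
  have N0: "D \<le> N0" "0 < N0" "s * 4 / e \<le> real N0"
    using real_nat_ceiling_ge[of "s * 4 / e"] by (auto simp: N0_def)
  have "norm (nrm (cesaro N a - a) - 0) < e" if N: "N0 \<le> N" for N
  proof -
    have Npos: "0 < N" using N N0 by simp
    have "p - cesaro N p = (\<Sum>n<D. wmono n ((p - cesaro N p) n))"
      by (rule poly_eq_sum_wmono) (auto simp: p(2) cesaro_def fun_eq_iff)
    also have "\<dots> = (\<Sum>n<D. scp_scale (of_real (real n / real N)) (wmono n (p n)))"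
    proof (rule sum.cong[OF refl])
      fix n assume "n \<in> {..<D}"
      then have n: "n \<le> N" using N N0 by simp
      have "1 - complex_of_real (real (N - n) / real N) = of_real (real n / real N)"
        using n Npos by (simp add: field_simps)
      then have "p n x - of_real (real (N - n) / real N) * p n x = of_real (real n / real N) * p n x" for x
        by (metis left_diff_distrib mult_1)
      then show "wmono n ((p - cesaro N p) n) = scp_scale (of_real (real n / real N)) (wmono n (p n))"
        by (auto simp: fun_eq_iff wmono_def scp_scale_def cesaro_def simp del: of_real_divide)
    qed
    finally have "bdd (p - cesaro N p) (\<Sum>n<D. cmod (of_real (real n / real N)) * c n)"
      by (metis (no_types, lifting) op_bound_sum op_bound_scale c finite_lessThan)
    moreover have "(\<Sum>n<D. cmod (of_real (real n / real N)) * c n) = s / N"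
      by (simp add: s_def norm_divide sum_divide_distrib)
    moreover have "s / N \<le> e / 4"
    proof -
      have "s * 4 / e \<le> real N" using N0 N by linarith
      then show ?thesis using e Npos by (simp add: field_simps)
    qed
    ultimately have 1: "bdd (p - cesaro N p) (e / 4)" using op_bound_mono by metis
    have 2: "bdd (cesaro N (a - p)) (e / 4)" by (rule op_bound_cesaro[OF p(3) Npos])
    have eq: "cesaro N a - a = cesaro N (a - p) - (p - cesaro N p) - (a - p)"
      by (simp add: cesaro_diff)
    have "bdd (cesaro N (a - p) - (p - cesaro N p) - (a - p)) (e / 4 + e / 4 + e / 4)"
      by (intro op_bound_diff 1 2 p(3))
    then have b: "bdd (cesaro N a - a) (e / 4 + e / 4 + e / 4)" by (simp only: eq)
    then have "nrm (cesaro N a - a) \<le> e / 4 + e / 4 + e / 4" by (rule scp_norm_le)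
    then show ?thesis using scp_norm_nonneg[OF b] e by simp
  qed
  then show "\<exists>N0. \<forall>N\<ge>N0. norm (nrm (cesaro N a - a) - 0) < e" by blast
qed

lemma quot_norm_le:
  assumes "K \<subseteq> \<A>" "k \<in> K" "x \<in> \<A>"
  shows "quot_norm nrm K x \<le> nrm (x - k)"
  unfolding quot_norm_def
proof (rule cInf_lower)
  show "bdd_below ((\<lambda>k. nrm (x - k)) ` K)"
    using assms by (intro bdd_belowI2[of _ 0] nrm_nonneg diff_in) auto
qed (use assms in auto)

lemma quot_norm_ge:
  assumes "K \<noteq> {}" "\<And>k. k \<in> K \<Longrightarrow> L \<le> nrm (x - k)"
  shows "L \<le> quot_norm nrm K x"
  unfolding quot_norm_def using assms by (intro cInf_greatest) auto

lemma quot_norm_nonneg: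
  assumes "K \<subseteq> \<A>" "K \<noteq> {}" "x \<in> \<A>"
  shows "0 \<le> quot_norm nrm K x"
  using assms(1,3) by (intro quot_norm_ge[OF assms(2)] nrm_nonneg diff_in) auto

text \<open>Evaluation of a coefficient is contractive, and it descends to the quotient when it
  vanishes on \<open>K\<close>.\<close>

lemma quot_norm_coeff:
  assumes "K \<subseteq> \<A>" "K \<noteq> {}" "x \<in> \<A>" "\<And>k. k \<in> K \<Longrightarrow> k n t = 0"
  shows "cmod (x n t) \<le> quot_norm nrm K x"
proof (rule quot_norm_ge[OF assms(2)])
  fix k assume "k \<in> K"
  then show "cmod (x n t) \<le> nrm (x - k)"
    using coeff_le_nrm[OF diff_in[OF assms(3), of k], of n t] assms(4)[of k] subsetD[OF assms(1)] by simp
qed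

lemma quot_norm_zero:
  assumes "K \<subseteq> \<A>" "x \<in> K"
  shows "quot_norm nrm K x = 0"
proof (rule antisym)
  show "quot_norm nrm K x \<le> 0"
    using quot_norm_le[OF assms, of x] scp_norm_le[OF op_bound_zero, of X \<phi>] assms by auto
  show "0 \<le> quot_norm nrm K x"
    using assms by (intro quot_norm_nonneg) auto
qed

text \<open>The Cesaro means of \<open>a\<close> lie in \<open>K\<close> and converge to
  \<open>a\<close>. Membership in a closed ideal is thereby reduced to monomials.\<close>

lemma ideal_containing_coeffs:
  assumes K: "is_ideal J mult scp_scale K" "closed_in_alg J nrm K"
    and a: "a \<in> J" "J \<subseteq> \<A>" "\<And>n. wmono n (a n) \<in> K"
  shows "a \<in> K"
proof -
  have "cesaro N a \<in> K" for N
    unfolding cesaro_eq_sum by (intro is_ideal_sum[OF K(1)] is_idealD(5)[OF K(1)] a)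
  moreover have "(\<lambda>N. nrm (cesaro N a - a)) \<longlonglongrightarrow> 0"
    using cesaro_tendsto a by blast
  ultimately show ?thesis
    using K(2)[unfolded closed_in_alg_def, rule_format, of "\<lambda>N. cesaro N a" a] a(1) by simp
qed

end

section \<open>Perfect and scattered parts, bump functions, and partitions of functions along open
  covers\<close>

section \<open>Perfect parts and localization\<close>

lemma funpow_fixed_mult:
  assumes "(f ^^ k) x = x"
  shows "(f ^^ (k * m)) x = x"
  by (induction m) (auto simp: funpow_add assms)

lemma continuous_map_cong_off:
  assumes "continuous_map X Y f" "\<And>x. x \<in> topspace X \<Longrightarrow> f x = g x"
  shows "continuous_map X Y g"
  using assms continuous_map_eq by blast

lemma C0_onI: "f \<in> C0 X \<Longrightarrow> (\<And>x. x \<notin> G \<Longrightarrow> f x = 0) \<Longrightarrow> f \<in> C0_on X G"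
  by (auto simp: C0_on_def)

lemma perfect_part_subset: "perfect_part X \<subseteq> topspace X"
  by (auto simp: perfect_part_def)

text \<open>The closure of a set that is dense in itself is again dense in itself, hence
  perfect.\<close>

lemma subset_derived_imp_subset_perfect_part:
  assumes "S \<subseteq> X derived_set_of S"
  shows "X closure_of S \<subseteq> perfect_part X"
proof -
  have S: "S \<subseteq> topspace X"
    by (rule order_trans[OF assms derived_set_of_subset_topspace])
  have "X closure_of S \<subseteq> X derived_set_of S"
    using assms by (auto simp: closure_of)
  also have "\<dots> \<subseteq> X derived_set_of (X closure_of S)"
    by (rule derived_set_of_mono[OF closure_of_subset[OF S]])
  finally have "X closure_of S \<subseteq> X derived_set_of (X closure_of S)" .
  then have "X closure_of S \<in> {P. P \<subseteq> topspace X \<and> closedin X P \<and> P \<subseteq> X derived_set_of P}"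
    using closure_of_subset_topspace[of X S] by simp
  then show ?thesis unfolding perfect_part_def by (rule Union_upper)
qed

lemma perfect_part_subset_derived: "perfect_part X \<subseteq> X derived_set_of (perfect_part X)"
proof
  fix x assume "x \<in> perfect_part X"
  then obtain P where P: "x \<in> P" "P \<subseteq> X derived_set_of P" "P \<subseteq> perfect_part X"
    by (auto simp: perfect_part_def)
  then show "x \<in> X derived_set_of (perfect_part X)"
    using derived_set_of_mono by blast
qed

lemma closedin_perfect_part: "closedin X (perfect_part X)"
  unfolding closure_of_subset_eq[symmetric]
  by (intro conjI perfect_part_subset subset_derived_imp_subset_perfect_part perfect_part_subset_derived)

text \<open>A nonempty set without isolated points would lie in the perfect part; this is the
  scatteredness of the complement.\<close>

lemma isolated_point_off_perfect_part:
  assumes "S \<subseteq> topspace X" "S \<inter> perfect_part X = {}" "S \<noteq> {}"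
  obtains x G where "openin X G" "S \<inter> G = {x}"
proof -
  have "\<not> S \<subseteq> X derived_set_of S"
    using subset_derived_imp_subset_perfect_part[of S X] closure_of_subset[OF assms(1)] assms by blast
  then obtain x where x: "x \<in> S" "x \<notin> X derived_set_of S" by blast
  then obtain G where "x \<in> G" "openin X G" "\<And>y. y \<noteq> x \<Longrightarrow> y \<in> S \<Longrightarrow> y \<notin> G"
    using assms(1) by (auto simp: in_derived_set_of)
  then have "openin X G \<and> S \<inter> G = {x}" using x by blast
  then show ?thesis using that by blast
qed

context semicrossed_system
begin

lemma Hausdorff: "Hausdorff_space X"
  by (rule metrizable_imp_Hausdorff_space[OF metrizable])

lemma normal: "normal_space X"
  by (rule metrizable_imp_normal_space[OF metrizable])

text \<open>Urysohn's lemma separates \<open>x\<close> from the complement of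
  \<open>G \<inter> U\<close>, where \<open>U\<close> sits inside a compact \<open>K\<close>; this
  \<open>K\<close> witnesses vanishing at infinity.\<close>

lemma bump:
  assumes G: "openin X G" "x \<in> G"
  obtains f where "f \<in> C0_on X G" "f x = 1" "\<And>y. cmod (f y) \<le> 1"
proof -
  have x: "x \<in> topspace X" using G openin_subset by blast
  obtain U K where U: "openin X U" "compactin X K" "x \<in> U" "U \<subseteq> K"
    using locally_compact x unfolding locally_compact_space_def by blast
  have "closedin X (topspace X - G \<inter> U)" using G U by blast
  moreover have "closedin X {x}"
    using Hausdorff x by (simp add: closedin_Hausdorff_singleton)
  moreover have "disjnt (topspace X - G \<inter> U) {x}" using G U by auto
  ultimately obtain h where h: "continuous_map X (top_of_set {0..1::real}) h"
      "h ` (topspace X - G \<inter> U) \<subseteq> {0}" "h ` {x} \<subseteq> {1}"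
    using Urysohn_lemma[OF normal, of "topspace X - G \<inter> U" "{x}" 0 1] by auto
  then have hc: "continuous_map X euclideanreal h" and h01: "\<And>y. y \<in> topspace X \<Longrightarrow> 0 \<le> h y \<and> h y \<le> 1"
    by (auto simp: continuous_map_in_subtopology image_subset_iff Pi_iff)
  have h0: "h y = 0" if "y \<in> topspace X" "y \<notin> G \<inter> U" for y
    using h(2) that by blast
  define f where "f y = (if y \<in> topspace X then complex_of_real (h y) else 0)" for y
  have "f \<in> C0 X"
    unfolding C0_def
  proof (intro CollectI conjI allI impI)
    show "continuous_map X euclidean f"
      by (rule continuous_map_cong_off[OF continuous_map_of_real[OF hc]]) (simp add: f_def)
    show "f y = 0" if "y \<notin> topspace X" for y using that by (simp add: f_def)
    fix e :: real assume "0 < e"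
    have "cmod (f y) < e" if "y \<in> topspace X - K" for y
    proof -
      have "h y = 0" using that U(4) by (intro h0) auto
      then show ?thesis using \<open>0 < e\<close> by (simp add: f_def)
    qed
    then show "\<exists>K. compactin X K \<and> (\<forall>x\<in>topspace X - K. cmod (f x) < e)" using U(2) by blast
  qed
  moreover have "f y = 0" if "y \<notin> G" for y
    using h0[of y] that by (simp add: f_def)
  moreover have "f x = 1" using h(3) x by (simp add: f_def)
  moreover have "cmod (f y) \<le> 1" for y using h01[of y] by (simp add: f_def)
  ultimately show ?thesis by (intro that[of f] C0_onI) auto
qed

text \<open>A partition of unity built by peeling off one open set \<open>G\<close>: a cutoff equal
  to 1 on the part of \<open>C\<close> that only \<open>G\<close> covers leaves a remainder
  supported in the union of the other sets.\<close>

lemma C0_finite_cover: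
  assumes add: "\<And>f g. f \<in> M \<Longrightarrow> g \<in> M \<Longrightarrow> f + g \<in> M" and zero: "0 \<in> M"
    and local: "\<And>G f. G \<in> \<F> \<Longrightarrow> f \<in> C0_on X G \<Longrightarrow> f \<in> M"
    and op: "\<And>G. G \<in> \<F> \<Longrightarrow> openin X G"
    and "finite \<F>" "closedin X C" "C \<subseteq> \<Union>\<F>" "f \<in> C0_on X C"
  shows "f \<in> M"
  using \<open>finite \<F>\<close> local op \<open>closedin X C\<close> \<open>C \<subseteq> \<Union>\<F>\<close> \<open>f \<in> C0_on X C\<close>
proof (induction \<F> arbitrary: C f rule: finite_induct)
  case empty
  then have "f = 0" by (auto simp: C0_on_def fun_eq_iff)
  show ?case unfolding \<open>f = 0\<close> by (rule zero)
next
  case (insert G \<F>)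
  have G: "openin X G" and \<F>: "openin X (\<Union>\<F>)" using insert.prems(2) by auto
  have f: "f \<in> C0 X" "\<And>x. x \<notin> C \<Longrightarrow> f x = 0" using insert.prems(5) by (auto simp: C0_on_def)
  have "closedin X (C - \<Union>\<F>)" using insert.prems(3) \<F> by (rule closedin_diff)
  moreover have "closedin X (topspace X - G)" using G by blast
  moreover have "disjnt (topspace X - G) (C - \<Union>\<F>)"
    using insert.prems(4) by (auto simp: disjnt_def)
  ultimately obtain h where h: "continuous_map X (top_of_set {0..1::real}) h"
      "h ` (topspace X - G) \<subseteq> {0}" "h ` (C - \<Union>\<F>) \<subseteq> {1}"
    using Urysohn_lemma[OF normal, of "topspace X - G" "C - \<Union>\<F>" 0 1] by auto
  then have hc: "continuous_map X euclideanreal h" and h01: "\<And>y. y \<in> topspace X \<Longrightarrow> 0 \<le> h y \<and> h y \<le> 1"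
    by (auto simp: continuous_map_in_subtopology image_subset_iff Pi_iff)
  \<comment> \<open>Doubling makes \<open>k\<close> equal 1 already where
    \<open>h \<ge> 1/2\<close>. The remainder \<open>f2\<close> then lives on the closed set
    \<open>C'\<close>, to which the induction hypothesis applies.\<close>
  define k where "k x = min 1 (2 * h x)" for x
  have kc: "continuous_map X euclideanreal k"
    unfolding k_def by (intro continuous_map_real_min continuous_map_real_mult hc) auto
  have k1: "continuous_map X euclidean (\<lambda>x. of_real (k x) :: complex)"
    by (rule continuous_map_of_real[OF kc])
  have k2: "continuous_map X euclidean (\<lambda>x. of_real (1 - k x) :: complex)"
    by (intro continuous_map_of_real continuous_map_diff kc) auto
  have kb: "0 \<le> k x \<and> k x \<le> 1" if "x \<in> topspace X" for x
    using h01[OF that] by (auto simp: k_def)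
  define f1 where "f1 = (\<lambda>x. f x * of_real (k x))"
  define f2 where "f2 = (\<lambda>x. f x * of_real (1 - k x))"
  have f1: "f1 \<in> C0 X"
    unfolding f1_def by (rule C0_mult_bounded[OF f(1) k1, of 1]) (use kb in auto)
  have f2: "f2 \<in> C0 X"
    unfolding f2_def by (rule C0_mult_bounded[OF f(1) k2, of 1]) (use kb in \<open>auto simp del: of_real_diff\<close>)
  have "f1 x = 0" if "x \<notin> G" for x
  proof (cases "x \<in> topspace X")
    case True
    then have "h x = 0" using h(2) that by blast
    then show ?thesis by (simp add: f1_def k_def)
  next
    case False
    then show ?thesis using C0D(2)[OF f1] by simp
  qed
  then have 1: "f1 \<in> M"
    by (intro insert.prems(1)[of G] C0_onI f1) auto
  define C' where "C' = C \<inter> {x \<in> topspace X. h x \<in> {..1/2}}"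
  have "closedin X C'"
    unfolding C'_def by (intro closedin_Int insert.prems(3) closedin_continuous_map_preimage[OF hc]) auto
  moreover have "C' \<subseteq> \<Union>\<F>"
  proof
    fix x assume x: "x \<in> C'"
    show "x \<in> \<Union>\<F>"
    proof (rule ccontr)
      assume "x \<notin> \<Union>\<F>"
      then have "x \<in> C - \<Union>\<F>" using x by (auto simp: C'_def)
      then have "h x = 1" using h(3) by blast
      then show False using x by (simp add: C'_def)
    qed
  qed
  moreover have "f2 x = 0" if "x \<notin> C'" for x
  proof (cases "x \<in> topspace X \<and> x \<in> C")
    case True
    then have "1/2 < h x" using that by (auto simp: C'_def)
    then show ?thesis by (simp add: f2_def k_def)
  next
    case False
    then show ?thesis using C0D(2)[OF f2] f(2)[of x] by (auto simp: f2_def)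
  qed
  ultimately have 2: "f2 \<in> M"
  proof (intro insert.IH[of C' f2])
    show "f2 \<in> C0_on X C'" if "\<And>x. x \<notin> C' \<Longrightarrow> f2 x = 0" by (intro C0_onI f2 that)
    show "g \<in> M" if "G' \<in> \<F>" "g \<in> C0_on X G'" for G' g using insert.prems(1) that by blast
    show "openin X G'" if "G' \<in> \<F>" for G' using insert.prems(2) that by blast
  qed
  have "f = f1 + f2" by (auto simp: f1_def f2_def fun_eq_iff algebra_simps)
  show ?case unfolding \<open>f = f1 + f2\<close> by (rule add[OF 1 2])
qed

text \<open>Cutting off the values of modulus below \<open>e\<close> leaves a function supported in
  a compact set, where finitely many members of the cover suffice. The result is an approximation,
  since \<open>M\<close> is not assumed closed.\<close>

lemma C0_local_to_global:
  assumes add: "\<And>f g. f \<in> M \<Longrightarrow> g \<in> M \<Longrightarrow> f + g \<in> M" and zero: "0 \<in> M"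
    and local: "\<And>G f. G \<in> \<G> \<Longrightarrow> f \<in> C0_on X G \<Longrightarrow> f \<in> M"
    and op: "\<And>G. G \<in> \<G> \<Longrightarrow> openin X G"
    and f: "f \<in> C0_on X (\<Union>\<G>)" and e: "0 < e"
  shows "\<exists>g\<in>M. \<forall>x. cmod (f x - g x) \<le> e"
proof -
  have f0: "f \<in> C0 X" and fG: "\<And>x. x \<notin> \<Union>\<G> \<Longrightarrow> f x = 0" using f by (auto simp: C0_on_def)
  have nc: "continuous_map X euclideanreal (\<lambda>x. cmod (f x))"
    by (rule continuous_map_norm[OF C0D(1)[OF f0]])
  \<comment> \<open>Soft thresholding: \<open>f s\<close> has modulus
    \<open>max 0 (\<bar>f\<bar> - e)\<close>, so it differs from \<open>f\<close> by at most
    \<open>e\<close>. The inner \<open>max\<close> keeps the denominator positive.\<close>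
  define s where "s x = max 0 (1 - e / max (cmod (f x)) e)" for x
  have sc: "continuous_map X euclideanreal s"
    unfolding s_def
  proof (intro continuous_map_real_max continuous_map_diff)
    show "continuous_map X euclideanreal (\<lambda>x. e / max (cmod (f x)) e)"
      using e by (intro continuous_map_real_divide continuous_map_real_max nc) auto
  qed auto
  have sb: "0 \<le> s x \<and> s x \<le> 1" for x
    using e by (auto simp: s_def max_def)
  define g where "g = (\<lambda>x. f x * of_real (s x))"
  have g0: "g \<in> C0 X"
    unfolding g_def by (rule C0_mult_bounded[OF f0 continuous_map_of_real[OF sc], of 1]) (use sb in auto)
  define C where "C = {x \<in> topspace X. cmod (f x) \<in> {e..}}"
  have C: "closedin X C"
    unfolding C_def by (rule closedin_continuous_map_preimage[OF nc]) auto
  obtain K where K: "compactin X K" "\<forall>x\<in>topspace X - K. cmod (f x) < e"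
    using C0D(3)[OF f0 e] by blast
  have "C \<subseteq> K" using K(2) by (force simp: C_def)
  then have "compactin X C" using C K(1) closed_compactin by blast
  moreover have "C \<subseteq> \<Union>\<G>" using fG e by (force simp: C_def)
  ultimately obtain \<F> where \<F>: "finite \<F>" "\<F> \<subseteq> \<G>" "C \<subseteq> \<Union>\<F>"
    using op unfolding compactin_def by blast
  have "g x = 0" if "x \<notin> C" for x
  proof (cases "x \<in> topspace X")
    case True
    then have "cmod (f x) < e" using that by (simp add: C_def)
    then show ?thesis using e by (simp add: g_def s_def max_def)
  qed (use C0D(2)[OF g0] in simp)
  then have "g \<in> M"
    using \<F> by (intro C0_finite_cover[of M \<F> C g, OF add zero]) (use local op C g0 in \<open>auto intro: C0_onI\<close>)
  moreover have "cmod (f x - g x) \<le> e" for x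
  proof -
    have "f x - g x = f x * of_real (1 - s x)" by (simp add: g_def algebra_simps)
    moreover have "\<bar>1 - s x\<bar> = 1 - s x" using sb[of x] by simp
    ultimately have "cmod (f x - g x) = cmod (f x) * (1 - s x)"
      by (simp only: norm_mult norm_of_real)
    also have "\<dots> \<le> e"
      using e by (cases "cmod (f x) \<le> e") (auto simp: s_def max_def)
    finally show ?thesis .
  qed
  ultimately show ?thesis by blast
qed

end

section \<open>Recurrent points, their closure, and relatively wandering open sets from Baire's
  theorem\<close>

section \<open>Recurrence and wandering sets\<close>

lemma recurrent_points_subset: "recurrent_points X \<phi> \<subseteq> topspace X"
  by (auto simp: recurrent_points_def)

context semicrossed_system
begin

abbreviation "Y \<equiv> X closure_of recurrent_points X \<phi>"

lemma recurrent_step: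
  assumes "x \<in> recurrent_points X \<phi>"
  shows "\<phi> x \<in> recurrent_points X \<phi>"
proof -
  obtain r where x: "x \<in> topspace X" and r: "strict_mono r" "\<forall>i::nat. 0 < r i" "limitin X (\<lambda>i. (\<phi> ^^ r i) x) x sequentially"
    using assms by (auto simp: recurrent_points_def)
  have "limitin X (\<phi> \<circ> (\<lambda>i. (\<phi> ^^ r i) x)) (\<phi> x) sequentially"
    by (rule continuous_map_limit[OF cont r(3)])
  then have "limitin X (\<lambda>i. (\<phi> ^^ r i) (\<phi> x)) (\<phi> x) sequentially"
    by (simp add: o_def funpow_swap1)
  then show ?thesis
    using orbit_in[OF x, of 1] r by (auto simp: recurrent_points_def)
qed

lemma Y_invariant: "x \<in> Y \<Longrightarrow> (\<phi> ^^ k) x \<in> Y"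
proof (induction k)
  case (Suc k)
  have "\<phi> ` Y \<subseteq> X closure_of (\<phi> ` recurrent_points X \<phi>)"
    by (rule continuous_map_image_closure_subset[OF cont])
  also have "\<dots> \<subseteq> Y" by (rule closure_of_mono) (use recurrent_step in auto)
  finally show ?case using Suc by auto
qed simp

text \<open>The given return times might stay bounded. A periodic point returns at multiples of its
  period; otherwise a return closer than all those up to time \<open>N\<close> must come after
  \<open>N\<close>.\<close>

lemma recurrent_if_returns:
  assumes M: "Metric_space M d" and X: "X = Metric_space.mtopology M d" and x: "x \<in> topspace X"
    and ret: "\<And>n. \<exists>k\<ge>1. d ((\<phi> ^^ k) x) x < 1 / real (Suc n)"
  shows "x \<in> recurrent_points X \<phi>"
proof -
  interpret Metric_space M d by (rule M)
  have top: "topspace X = M" by (simp add: X)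
  have orb: "(\<phi> ^^ k) x \<in> M" for k using orbit_in[OF x] top by simp
  have xM: "x \<in> M" using x top by simp
  have large: "\<exists>k>N. d ((\<phi> ^^ k) x) x < 1 / real (Suc n)" for n N
  proof (cases "\<exists>k\<ge>1. (\<phi> ^^ k) x = x")
    case True
    then obtain k where k: "1 \<le> k" "(\<phi> ^^ k) x = x" by blast
    have "(\<phi> ^^ (k * Suc N)) x = x" by (rule funpow_fixed_mult[OF k(2)])
    moreover have "N < k * Suc N" using k(1) by (cases k) auto
    ultimately show ?thesis using xM by (intro exI[of _ "k * Suc N"]) (simp del: mult_Suc_right)
  next
    case False
    \<comment> \<open>The wanted tolerance together with the distances at times 1 to
      \<open>N\<close>, all positive here; a return closer than \<open>Min D\<close> beats every one
      of them.\<close>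
    define D where "D = insert (1 / real (Suc n)) ((\<lambda>j. d ((\<phi> ^^ j) x) x) ` {1..N})"
    have D: "finite D" "D \<noteq> {}" by (auto simp: D_def)
    have "0 < t" if t: "t \<in> D" for t
    proof (cases "t = 1 / real (Suc n)")
      case nt: False
      then obtain j where "1 \<le> j" "t = d ((\<phi> ^^ j) x) x" using t by (auto simp: D_def)
      then show ?thesis using False mdist_pos_less orb xM by metis
    qed simp
    then have "0 < Min D" using D by simp
    then obtain n' where n': "1 / real (Suc n') < Min D"
      using reals_Archimedean by (metis inverse_eq_divide)
    obtain k where k: "1 \<le> k" "d ((\<phi> ^^ k) x) x < 1 / real (Suc n')" using ret by blast
    then have "d ((\<phi> ^^ k) x) x < t" if "t \<in> D" for t
      using n' Min_le[OF D(1) that] by linarith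
    then have "d ((\<phi> ^^ k) x) x < 1 / real (Suc n)" "\<And>j. j \<in> {1..N} \<Longrightarrow> d ((\<phi> ^^ k) x) x < d ((\<phi> ^^ j) x) x"
      by (auto simp: D_def)
    moreover have "N < k"
    proof (rule ccontr)
      assume "\<not> N < k"
      then have "k \<in> {1..N}" using k(1) by auto
      then show False using calculation(2) by blast
    qed
    ultimately show ?thesis by blast
  qed
  \<comment> \<open>Each choice uses the previous time as the lower bound \<open>N\<close>, so the
    times increase strictly while the tolerances shrink.\<close>
  have "\<exists>r. \<forall>i. (0 < r i \<and> d ((\<phi> ^^ r i) x) x < 1 / real (Suc i)) \<and> r i < r (Suc i)"
  proof (rule dependent_nat_choice)
    show "\<exists>k. 0 < k \<and> d ((\<phi> ^^ k) x) x < 1 / real (Suc 0)" using large[of 0 0] by blast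
    show "\<exists>k'. (0 < k' \<and> d ((\<phi> ^^ k') x) x < 1 / real (Suc (Suc i))) \<and> k < k'" for k i :: nat
      using large[of k "Suc i"] by (metis bot_nat_0.not_eq_extremum less_nat_zero_code)
  qed
  then obtain r where r: "\<And>i. 0 < r i" "\<And>i. d ((\<phi> ^^ r i) x) x < 1 / real (Suc i)" "\<And>i. r i < r (Suc i)"
    by blast
  have "limitin X (\<lambda>i. (\<phi> ^^ r i) x) x sequentially"
    unfolding X limitin_metric eventually_sequentially
  proof (intro conjI allI impI)
    fix e :: real assume "0 < e"
    then obtain n where n: "1 / real (Suc n) < e" using reals_Archimedean by (metis inverse_eq_divide)
    have "d ((\<phi> ^^ r i) x) x < e" if "n \<le> i" for i
    proof -
      have "1 / real (Suc i) \<le> 1 / real (Suc n)" using that by (simp add: frac_le)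
      then show ?thesis using r(2)[of i] n by linarith
    qed
    then show "\<exists>N. \<forall>i\<ge>N. (\<phi> ^^ r i) x \<in> M \<and> d ((\<phi> ^^ r i) x) x < e" using orb by blast
  qed (rule xM)
  moreover have "strict_mono r" using r(3) by (simp add: strict_mono_Suc_iff)
  ultimately show ?thesis using x r(1) by (auto simp: recurrent_points_def)
qed

text \<open>Otherwise the points of \<open>Z - Y\<close> returning within distance \<open>1 / n\<close> form a dense
  open set for every \<open>n\<close>, and Baire's theorem yields a recurrent point outside \<open>Y\<close>.\<close>

lemma wandering_open:
  assumes Z: "closedin X Z" "\<not> Z \<subseteq> Y"
  obtains G where "openin X G" "G \<inter> Y = {}" "G \<inter> Z \<noteq> {}"
    "\<And>k p. 1 \<le> k \<Longrightarrow> p \<in> G \<inter> Z \<Longrightarrow> (\<phi> ^^ k) p \<notin> G"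
proof (rule ccontr)
  note wanderI = that
  assume contra: "\<not> thesis"
  have nonwand: "\<exists>k p. 1 \<le> k \<and> p \<in> G \<inter> Z \<and> (\<phi> ^^ k) p \<in> G"
    if "openin X G" "G \<inter> Y = {}" "G \<inter> Z \<noteq> {}" for G
  proof (rule ccontr)
    assume "\<not> ?thesis"
    then have "\<And>k p. 1 \<le> k \<Longrightarrow> p \<in> G \<inter> Z \<Longrightarrow> (\<phi> ^^ k) p \<notin> G" by blast
    from wanderI[OF \<open>openin X G\<close> \<open>G \<inter> Y = {}\<close> \<open>G \<inter> Z \<noteq> {}\<close> this] show False
      using contra by simp
  qed
  obtain M d where M: "Metric_space M d" and X: "X = Metric_space.mtopology M d"
    using metrizable unfolding metrizable_space_def by blast
  interpret Metric_space M d by (rule M)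
  have top: "topspace X = M" by (simp add: X)
  have ZM: "Z \<subseteq> M" using closedin_subset[OF Z(1)] top by simp
  have Yc: "openin X (topspace X - Y)"
    by (intro openin_diff openin_topspace closedin_closure_of)
  \<comment> \<open>This subspace is open in the closed subspace \<open>Z\<close>, hence locally
    compact; with regularity, Baire's theorem applies to it.\<close>
  define W where "W = subtopology X (Z - Y)"
  have topW: "topspace W = Z - Y" using ZM top by (auto simp: W_def)
  have "W = subtopology (subtopology X Z) (topspace X - Y)"
    unfolding W_def subtopology_subtopology using ZM top by (intro arg_cong[where f = "subtopology X"]) auto
  moreover have "openin (subtopology X Z) (Z \<inter> (topspace X - Y))"
    using Yc by (auto simp: openin_subtopology_Int2)
  moreover have "subtopology (subtopology X Z) (topspace X - Y) = subtopology (subtopology X Z) (Z \<inter> (topspace X - Y))"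
    unfolding subtopology_subtopology by (intro arg_cong[where f = "subtopology X"]) auto
  ultimately have lc: "locally_compact_space W"
    using locally_compact_space_open_subset[OF _ locally_compact_space_closed_subset[OF locally_compact Z(1)]]
      Hausdorff_space_subtopology[OF Hausdorff] by metis
  have reg: "regular_space W"
    unfolding W_def by (intro regular_space_subtopology metrizable_imp_regular_space metrizable)
  define D where "D n = {x \<in> topspace W. \<exists>k\<ge>1. d ((\<phi> ^^ k) x) x < 1 / real (Suc n)}" for n
  have distc: "continuous_map W euclideanreal (\<lambda>x. d ((\<phi> ^^ k) x) x)" for k
  proof -
    have "continuous_map X euclideanreal (\<lambda>x. mdist (metric (M, d)) ((\<phi> ^^ k) x) x)"
      using cont_funpow[of k] by (intro continuous_map_mdist) (simp_all add: X)
    then show ?thesis unfolding W_def by (simp add: continuous_map_from_subtopology)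
  qed
  have Dopen: "openin W (D n)" for n
  proof -
    have "D n = (\<Union>k\<in>{1..}. {x \<in> topspace W. d ((\<phi> ^^ k) x) x \<in> {..<1 / real (Suc n)}})"
      by (auto simp: D_def)
    also have "openin W \<dots>"
    proof (rule openin_Union)
      fix S assume "S \<in> (\<lambda>k. {x \<in> topspace W. d ((\<phi> ^^ k) x) x \<in> {..<1 / real (Suc n)}}) ` {1..}"
      then obtain k where "S = {x \<in> topspace W. d ((\<phi> ^^ k) x) x \<in> {..<1 / real (Suc n)}}" by blast
      then show "openin W S"
        using openin_continuous_map_preimage[OF distc[of k], of "{..<1 / real (Suc n)}"] by simp
    qed
    finally show ?thesis .
  qed
  have Ddense: "W closure_of D n = topspace W" for n
    unfolding dense_intersects_open
  proof (intro allI impI)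
    fix T assume T: "openin W T \<and> T \<noteq> {}"
    then obtain T' where T': "openin X T'" "T = T' \<inter> (Z - Y)" by (auto simp: W_def openin_subtopology)
    obtain x where x: "x \<in> T" using T by blast
    \<comment> \<open>Half of the tolerance: a point \<open>p\<close> and its return
      \<open>(\<phi> ^^ k) p\<close> both lie within \<delta> of \<open>x\<close>, hence within
      \<open>1 / Suc n\<close> of each other.\<close>
    define \<delta> where "\<delta> = 1 / (2 * real (Suc n))"
    define G where "G = T' \<inter> (topspace X - Y) \<inter> mball x \<delta>"
    have "openin X G" unfolding G_def using T'(1) Yc by (intro openin_Int) (auto simp: X)
    moreover have "G \<inter> Y = {}" by (auto simp: G_def)
    moreover have "x \<in> G \<inter> Z" using x T' ZM top by (auto simp: G_def \<delta>_def)
    ultimately obtain k p where kp: "1 \<le> k" "p \<in> G \<inter> Z" "(\<phi> ^^ k) p \<in> G" using nonwand[of G] by blast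
    have "d ((\<phi> ^^ k) p) p \<le> d ((\<phi> ^^ k) p) x + d x p"
      using kp by (intro triangle) (auto simp: G_def)
    also have "\<dots> < \<delta> + \<delta>" using kp by (intro add_strict_mono) (auto simp: G_def commute)
    also have "\<dots> = 1 / real (Suc n)" by (simp add: \<delta>_def field_simps)
    finally have "p \<in> D n" using kp topW by (auto simp: D_def G_def)
    moreover have "p \<in> T" using kp T' by (auto simp: G_def)
    ultimately show "D n \<inter> T \<noteq> {}" by blast
  qed
  have "W closure_of \<Inter>(range D) = topspace W"
    by (rule Baire_category) (use lc reg Dopen Ddense in auto)
  moreover have "topspace W \<noteq> {}" using Z(2) topW by blast
  ultimately have "\<Inter>(range D) \<noteq> {}" using closure_of_empty[of W] by metis
  then obtain x where x: "\<And>n. x \<in> D n" by auto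
  then have xZ: "x \<in> Z - Y" using topW by (auto simp: D_def)
  moreover have "x \<in> recurrent_points X \<phi>"
    using x xZ ZM top by (intro recurrent_if_returns[OF M X]) (auto simp: D_def)
  ultimately show False
    using closure_of_subset[OF recurrent_points_subset[of X \<phi>]] by blast
qed

end

section \<open>The candidate ideal \<open>J\<close> and its hypocompactness\<close>

section \<open>Hypocompactness of the candidate\<close>

lemma wmono_add: "wmono n (f + g) = wmono n f + wmono n g"
  by (simp add: fun_eq_iff wmono_apply)

lemma wmono_diff: "wmono n (f - g) = wmono n f - wmono n g"
  by (simp add: fun_eq_iff wmono_apply)

lemma wmono_zero: "wmono n 0 = 0"
  by (simp add: fun_eq_iff wmono_apply)

text \<open>In degree \<open>N\<close> the two copies of \<open>f\<close> are evaluated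
  \<open>N - n\<close> steps apart on one orbit. For \<open>f\<close> supported in a wandering set
  their product vanishes.\<close>

lemma scp_mult_wmono_sandwich:
  "scp_mult \<phi> (scp_mult \<phi> (wmono n f) y) (wmono n f) N x =
    (if 2 * n \<le> N then f ((\<phi> ^^ (N - n)) x) * y (N - 2 * n) ((\<phi> ^^ n) x) * f x else 0)"
proof (cases "2 * n \<le> N")
  case True
  then have "(\<phi> ^^ (N - n - n)) ((\<phi> ^^ n) x) = (\<phi> ^^ (N - n)) x"
    by (simp flip: funpow_add[THEN fun_cong, unfolded comp_apply])
  moreover have "N - n - n = N - 2 * n" by simp
  ultimately show ?thesis using True by (simp add: scp_mult_wmono_left scp_mult_wmono_right)
next
  case False
  then have "\<not> (n \<le> N - n \<and> n \<le> N)" by linarith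
  with False show ?thesis by (auto simp: scp_mult_wmono_left scp_mult_wmono_right)
qed

context semicrossed_system
begin

abbreviation "P \<equiv> perfect_part X"
abbreviation "W \<equiv> topspace X - Y"

definition J :: "(nat \<Rightarrow> 'a \<Rightarrow> complex) set" where
  "J = {a \<in> \<A>. (\<forall>x\<in>P. a 0 x = 0) \<and> (\<forall>n. \<forall>x\<in>Y. a n x = 0)}"

lemma J_subset: "J \<subseteq> \<A>"
  by (auto simp: J_def)

text \<open>Forward invariance of \<open>Y\<close> handles the shifted factor in every degree. In
  degree 0 the product is pointwise, which handles \<open>P\<close>.\<close>

lemma J_ideal: "is_ideal \<A> mult scp_scale J"
proof -
  have "a \<bullet>\<^sub>\<phi> b \<in> J" if "a \<in> \<A>" "b \<in> \<A>" "a \<in> J \<or> b \<in> J" for a b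
  proof -
    have "(a \<bullet>\<^sub>\<phi> b) 0 x = 0" if "x \<in> P" for x
      using \<open>a \<in> J \<or> b \<in> J\<close> that by (auto simp: scp_mult_def J_def)
    moreover have "(a \<bullet>\<^sub>\<phi> b) n x = 0" if "x \<in> Y" for n x
      unfolding scp_mult_def
    proof (intro sum.neutral ballI)
      fix m
      show "a m ((\<phi> ^^ (n - m)) x) * b (n - m) x = 0"
        using \<open>a \<in> J \<or> b \<in> J\<close> that Y_invariant[OF that] by (auto simp: J_def)
    qed
    ultimately show ?thesis using mult_in[OF that(1,2)] by (simp add: J_def)
  qed
  then show ?thesis
    unfolding is_ideal_def
    using zero_in add_in uminus_in scale_in by (auto simp: J_def scp_scale_def)
qed

lemma J_mult: "a \<in> J \<Longrightarrow> b \<in> J \<Longrightarrow> a \<bullet>\<^sub>\<phi> b \<in> J"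
  using is_idealD(6)[OF J_ideal] J_subset by blast

lemma J_coeff: "a \<in> J \<Longrightarrow> a n \<in> C0_on X W" "a \<in> J \<Longrightarrow> a 0 \<in> C0_on X (W - P)"
  using C0D(2)[OF coeff_C0] by (auto simp: J_def C0_on_def coeff_C0)

lemma wmono_in_J: "f \<in> C0_on X W \<Longrightarrow> 1 \<le> n \<Longrightarrow> wmono n f \<in> J"
  using wmono_in[of f n] by (auto simp: J_def C0_on_def wmono_apply)

lemma wmono0_in_J: "f \<in> C0_on X (W - P) \<Longrightarrow> wmono 0 f \<in> J"
  using wmono_in[of f 0] by (auto simp: J_def C0_on_def wmono_apply)

lemma openin_W: "openin X W"
  by (intro openin_diff openin_topspace closedin_closure_of)

lemma C0_on_mono: "f \<in> C0_on X G \<Longrightarrow> G \<subseteq> H \<Longrightarrow> f \<in> C0_on X H"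
  by (auto simp: C0_on_def)

text \<open>The functions \<open>f\<close> with \<open>wmono n f\<close> in \<open>K\<close> form an
  additive set, so \<open>C0_local_to_global\<close> gives approximants in it; closedness of
  \<open>K\<close> absorbs the error.\<close>

lemma wmono_local_to_global:
  assumes K: "is_ideal J mult scp_scale K" "closed_in_alg J nrm K"
    and local: "\<And>G f. G \<in> \<G> \<Longrightarrow> f \<in> C0_on X G \<Longrightarrow> wmono n f \<in> K"
    and op: "\<And>G. G \<in> \<G> \<Longrightarrow> openin X G"
    and f: "f \<in> C0_on X (\<Union>\<G>)" and fJ: "wmono n f \<in> J"
  shows "wmono n f \<in> K"
proof -
  define M where "M = {f. wmono n f \<in> K}"
  have "\<exists>g\<in>M. \<forall>x. cmod (f x - g x) \<le> 1 / real (Suc i) / 2" for i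
    using local is_idealD(2,3)[OF K(1)]
    by (intro C0_local_to_global[of M \<G>] op f) (auto simp: M_def wmono_add wmono_zero)
  then obtain g where g: "\<And>i. g i \<in> M" "\<And>i x. cmod (f x - g i x) \<le> 1 / real (Suc i) / 2" by metis
  have "(\<lambda>i. nrm (wmono n (g i) - wmono n f)) \<longlonglongrightarrow> 0"
  proof (rule LIMSEQ_norm_0)
    fix i
    have b: "bdd (wmono n (g i) - wmono n f) (1 / real (Suc i) / 2)"
      unfolding wmono_diff[symmetric] using g(2)[of _ i] by (intro bdd_wmono) (auto simp: norm_minus_commute)
    have "nrm (wmono n (g i) - wmono n f) \<le> 1 / real (Suc i) / 2" by (rule scp_norm_le[OF b])
    also have "\<dots> < 1 / real (Suc i)" by (simp add: field_simps)
    finally show "norm (nrm (wmono n (g i) - wmono n f)) < 1 / real (Suc i)"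
      using scp_norm_nonneg[OF b] by simp
  qed
  moreover have "\<forall>i. wmono n (g i) \<in> K" using g(1) by (simp add: M_def)
  ultimately show ?thesis
    using K(2)[unfolded closed_in_alg_def, rule_format, of "\<lambda>i. wmono n (g i)" "wmono n f"] fJ by simp
qed

section \<open>Closed ideals \<open>K\<close> of \<open>J\<close> for which \<open>J / K\<close> has
  no nonzero compact element\<close>

context
  fixes K
  assumes K: "is_ideal J mult scp_scale K" "closed_in_alg J nrm K"
    and no_compact: "\<And>a. a \<in> J \<Longrightarrow> compact_elem_quot J mult nrm K a \<Longrightarrow> a \<in> K"
begin

lemma K_subset: "K \<subseteq> J" "K \<subseteq> \<A>"
  using is_idealD(1)[OF K(1)] J_subset by auto

text \<open>Two-sided multiplication by \<open>a\<close> is then zero on \<open>J / K\<close>, so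
  \<open>a\<close> is compact modulo \<open>K\<close>.\<close>

lemma in_K_if_sandwich:
  assumes "a \<in> J" "\<And>y. y \<in> J \<Longrightarrow> a \<bullet>\<^sub>\<phi> y \<bullet>\<^sub>\<phi> a \<in> K"
  shows "a \<in> K"
proof (rule no_compact[OF assms(1)])
  show "compact_elem_quot J mult nrm K a"
    unfolding compact_elem_quot_def
  proof (intro allI impI exI[of _ id] exI[of _ 0] conjI)
    show "0 \<in> J" by (rule is_idealD(2)[OF J_ideal])
    fix y :: "nat \<Rightarrow> nat \<Rightarrow> 'a \<Rightarrow> complex"
    assume y: "\<forall>i. y i \<in> J \<and> quot_norm nrm K (y i) \<le> 1"
    have "quot_norm nrm K (a \<bullet>\<^sub>\<phi> y i \<bullet>\<^sub>\<phi> a) = 0" for i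
      using y by (intro quot_norm_zero K_subset assms(2)) auto
    then show "(\<lambda>i. quot_norm nrm K (a \<bullet>\<^sub>\<phi> y (id i) \<bullet>\<^sub>\<phi> a - 0)) \<longlonglongrightarrow> 0" by simp
  qed (simp add: strict_mono_def)
qed

text \<open>The union \<open>V\<close> of all open sets with the desired property has it too, by
  localisation. If it misses a point of \<open>W\<close>, a set \<open>G\<close> wandering relative
  to the complement of \<open>V\<close> has the property as well, although it is not contained in
  \<open>V\<close>.\<close>

lemma positive_degree_in_K:
  assumes "1 \<le> n" "f \<in> C0_on X W"
  shows "wmono n f \<in> K"
proof -
  \<comment> \<open>All degrees \<open>n \<ge> 1\<close> are treated at once because the sandwich by
    a monomial of degree \<open>n\<close> lands in the degrees \<open>N \<ge> 2 * n\<close>.\<close>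
  define \<G> where "\<G> = {G. openin X G \<and> G \<subseteq> W \<and> (\<forall>n\<ge>1. \<forall>f\<in>C0_on X G. wmono n f \<in> K)}"
  define V where "V = \<Union>\<G>"
  have Vop: "openin X V" unfolding V_def by (intro openin_Union) (auto simp: \<G>_def)
  have VW: "V \<subseteq> W" by (auto simp: V_def \<G>_def)
  have V: "wmono n f \<in> K" if "1 \<le> n" "f \<in> C0_on X V" for n f
  proof (rule wmono_local_to_global[OF K, of \<G>])
    show "f \<in> C0_on X (\<Union>\<G>)" using that by (simp add: V_def)
    show "wmono n f \<in> J" using that VW by (intro wmono_in_J) (auto intro: C0_on_mono)
  qed (use that in \<open>auto simp: \<G>_def\<close>)
  have "topspace X - V \<subseteq> Y"
  proof (rule ccontr)
    assume "\<not> topspace X - V \<subseteq> Y"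
    moreover have "closedin X (topspace X - V)" using Vop by blast
    ultimately obtain G where G: "openin X G" "G \<inter> Y = {}" "G \<inter> (topspace X - V) \<noteq> {}"
        "\<And>k p. 1 \<le> k \<Longrightarrow> p \<in> G \<inter> (topspace X - V) \<Longrightarrow> (\<phi> ^^ k) p \<notin> G"
      using wandering_open[of "topspace X - V"] by metis
    have GT: "G \<subseteq> topspace X" using G(1) by (rule openin_subset)
    have "wmono n f \<in> K" if n: "1 \<le> n" and f: "f \<in> C0_on X G" for n f
    proof (rule in_K_if_sandwich)
      show a: "wmono n f \<in> J"
        using n f G(2) GT by (intro wmono_in_J) (auto intro: C0_on_mono)
      fix y assume y: "y \<in> J"
      let ?b = "wmono n f \<bullet>\<^sub>\<phi> y \<bullet>\<^sub>\<phi> wmono n f"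
      have bJ: "?b \<in> J" by (intro J_mult a y)
      have "wmono N (?b N) \<in> K" for N
      proof (cases "2 * n \<le> N")
        case False
        then have "?b N = 0" by (simp add: fun_eq_iff scp_mult_wmono_sandwich)
        then show ?thesis using is_idealD(2)[OF K(1)] by (simp add: wmono_zero)
      next
        case True
        \<comment> \<open>A nonzero value requires \<open>x\<close> and
          \<open>(\<phi> ^^ (N - n)) x\<close> to lie in \<open>G\<close>; for \<open>x\<close>
          outside \<open>V\<close> this is a forbidden return after \<open>N - n \<ge> 1\<close>
          steps.\<close>
        have "?b N x = 0" if "x \<notin> V" for x
        proof (rule ccontr)
          assume "?b N x \<noteq> 0"
          then have "f ((\<phi> ^^ (N - n)) x) \<noteq> 0" "f x \<noteq> 0"
            by (auto simp: scp_mult_wmono_sandwich split: if_splits)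
          then have "x \<in> G" "(\<phi> ^^ (N - n)) x \<in> G" using C0_onD(2)[OF f] by blast+
          moreover have "1 \<le> N - n" using True n by simp
          ultimately show False using G(4)[of "N - n" x] GT that by blast
        qed
        then have "?b N \<in> C0_on X V"
          using coeff_C0 bJ J_subset by (intro C0_onI) auto
        then show ?thesis using True n by (intro V) auto
      qed
      then show "?b \<in> K"
        by (intro ideal_containing_coeffs[OF K bJ J_subset])
    qed
    then have "G \<in> \<G>" using G(1,2) GT by (auto simp: \<G>_def)
    then have "G \<subseteq> V" by (auto simp: V_def)
    then show False using G(3) by blast
  qed
  then have "W \<subseteq> V" by blast
  then show ?thesis using assms by (intro V) (auto intro: C0_on_mono)
qed

text \<open>The set \<open>G\<close> contains only one point \<open>x\<close> outside
  \<open>V\<close>. Modulo \<open>K\<close>, the sandwich of \<open>y\<close> by \<open>f\<close> is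
  therefore \<open>y 0 x\<close> times \<open>f\<^sup>2\<close>, an operator of rank at most
  one.\<close>

lemma degree_zero_in_K:
  assumes "f \<in> C0_on X (W - P)"
  shows "wmono 0 f \<in> K"
proof -
  define \<G> where "\<G> = {G. openin X G \<and> G \<subseteq> W - P \<and> (\<forall>f\<in>C0_on X G. wmono 0 f \<in> K)}"
  define V where "V = \<Union>\<G>"
  have VW: "V \<subseteq> W - P" by (auto simp: V_def \<G>_def)
  have V: "wmono 0 f \<in> K" if "f \<in> C0_on X V" for f
  proof (rule wmono_local_to_global[OF K, of \<G>])
    show "f \<in> C0_on X (\<Union>\<G>)" using that by (simp add: V_def)
    show "wmono 0 f \<in> J" using that VW by (intro wmono0_in_J) (auto intro: C0_on_mono)
  qed (auto simp: \<G>_def)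
  have "W - P \<subseteq> V"
  proof (rule ccontr)
    assume "\<not> W - P \<subseteq> V"
    then have "W - P - V \<subseteq> topspace X" "(W - P - V) \<inter> P = {}" "W - P - V \<noteq> {}" by blast+
    then obtain x G' where G': "openin X G'" "(W - P - V) \<inter> G' = {x}"
      by (rule isolated_point_off_perfect_part)
    \<comment> \<open>Cutting \<open>G'\<close> down to \<open>W - P\<close> leaves \<open>x\<close>
      as its only point outside \<open>V\<close>.\<close>
    define G where "G = G' \<inter> (W - P)"
    have G: "openin X G" "G \<subseteq> W - P" "G - {x} \<subseteq> V" "x \<in> G"
      using G' openin_W closedin_perfect_part[of X] by (auto simp: G_def intro!: openin_Int openin_diff)
    have "wmono 0 f \<in> K" if f: "f \<in> C0_on X G" for f
    proof -
      let ?a = "wmono 0 f"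
      define f2 where "f2 = (\<lambda>t. f t * f t)"
      have fC: "f \<in> C0 X" and f2C: "f2 \<in> C0 X" using f C0_mult by (auto simp: C0_on_def f2_def)
      have f2: "f2 \<in> C0_on X G" using f f2C by (auto simp: C0_on_def f2_def)
      have aJ: "?a \<in> J" and a2J: "wmono 0 f2 \<in> J"
        using f f2 G(2) by (auto intro!: wmono0_in_J intro: C0_on_mono)
      \<comment> \<open>In degree 0 the two terms cancel at \<open>x\<close>, and off
        \<open>V\<close> there is no other point where \<open>f\<close> is nonzero; the positive
        degrees are already in \<open>K\<close>.\<close>
      have red: "?a \<bullet>\<^sub>\<phi> y \<bullet>\<^sub>\<phi> ?a - scp_scale (y 0 x) (wmono 0 f2) \<in> K" (is "?b \<in> K") if y: "y \<in> J" for y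
      proof (rule ideal_containing_coeffs[OF K _ J_subset])
        show bJ: "?b \<in> J"
          by (intro is_ideal_diff[OF J_ideal] J_mult aJ y is_idealD(5)[OF J_ideal] a2J)
        fix N
        show "wmono N (?b N) \<in> K"
        proof (cases "N = 0")
          case True
          have "?b 0 t = f t * y 0 t * f t - y 0 x * (f t * f t)" for t
            by (simp add: scp_mult_wmono_sandwich scp_scale_def wmono_apply f2_def)
          moreover have "f t = 0 \<or> t = x" if "t \<notin> V" for t
            using that G(3) C0_onD(2)[OF f, of t] by blast
          ultimately have "?b 0 t = 0" if "t \<notin> V" for t using that by fastforce
          then have "?b 0 \<in> C0_on X V" using coeff_C0[of ?b 0] bJ J_subset by (intro C0_onI) auto
          then show ?thesis unfolding True by (rule V)
        next
          case False
          then show ?thesis using J_coeff(1)[OF bJ] by (intro positive_degree_in_K) auto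
        qed
      qed
      show ?thesis
      \<comment> \<open>If evaluation at \<open>x\<close> is nonzero on \<open>K\<close>, then
        \<open>f\<^sup>2\<close> itself is in \<open>K\<close> and all sandwiches vanish modulo
        \<open>K\<close>. Otherwise the evaluation is a functional on \<open>J / K\<close>.\<close>
      proof (cases "\<exists>k\<in>K. k 0 x \<noteq> 0")
        case True
        then obtain k where k: "k \<in> K" "k 0 x \<noteq> 0" by blast
        then have kJ: "k \<in> J" using K_subset by blast
        have "?a \<bullet>\<^sub>\<phi> k \<bullet>\<^sub>\<phi> ?a \<in> K" by (intro is_idealD(6,7)[OF K(1)] aJ k)
        then have "scp_scale (k 0 x) (wmono 0 f2) \<in> K"
          using is_ideal_diff[OF K(1) _ red[OF kJ]] by fastforce
        then have "scp_scale (inverse (k 0 x)) (scp_scale (k 0 x) (wmono 0 f2)) \<in> K"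
          by (rule is_idealD(5)[OF K(1)])
        moreover have "scp_scale (inverse (k 0 x)) (scp_scale (k 0 x) (wmono 0 f2)) = wmono 0 f2"
          using k(2) by (simp add: scp_scale_def fun_eq_iff)
        ultimately have f2K: "wmono 0 f2 \<in> K" by (simp only:)
        show ?thesis
        proof (rule in_K_if_sandwich[OF aJ])
          fix y assume "y \<in> J"
          from is_idealD(3)[OF K(1) red[OF this] is_idealD(5)[OF K(1) f2K, of "y 0 x"]]
          show "?a \<bullet>\<^sub>\<phi> y \<bullet>\<^sub>\<phi> ?a \<in> K" by simp
        qed
      next
        case False
        obtain c where c: "0 < c" "\<And>t. cmod (f2 t) \<le> c" using C0_bounded[OF f2C] by blast
        show ?thesis
        proof (rule no_compact[OF aJ], unfold compact_elem_quot_def, intro allI impI)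
          fix y :: "nat \<Rightarrow> nat \<Rightarrow> 'a \<Rightarrow> complex"
          assume y: "\<forall>i. y i \<in> J \<and> quot_norm nrm K (y i) \<le> 1"
          \<comment> \<open>The evaluation is contractive on the quotient, so the scalars
            \<open>y i 0 x\<close> are bounded and Bolzano-Weierstrass yields a limit
            \<open>l\<close>.\<close>
          have "cmod (y i 0 x) \<le> 1" for i
            using quot_norm_coeff[OF K_subset(2), of "y i" 0 x] False y is_idealD(2)[OF K(1)] J_subset
            by (metis empty_iff order_trans subsetD)
          then have "bounded (range (\<lambda>i. y i 0 x))" by (auto simp: bounded_iff)
          then obtain l r where r: "strict_mono r" "((\<lambda>i. y i 0 x) \<circ> r) \<longlonglongrightarrow> l"
            using bounded_imp_convergent_subsequence by blast
          define z where "z = scp_scale l (wmono 0 f2)"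
          have zJ: "z \<in> J" unfolding z_def by (rule is_idealD(5)[OF J_ideal a2J])
          have "(\<lambda>i. quot_norm nrm K (?a \<bullet>\<^sub>\<phi> y (r i) \<bullet>\<^sub>\<phi> ?a - z)) \<longlonglongrightarrow> 0"
          proof (rule tendsto_sandwich)
            have wA: "?a \<bullet>\<^sub>\<phi> y (r i) \<bullet>\<^sub>\<phi> ?a - z \<in> \<A>" for i
              using is_ideal_diff[OF J_ideal J_mult[OF J_mult[OF aJ] aJ] zJ] y J_subset by blast
            show "\<forall>\<^sub>F i in sequentially. 0 \<le> quot_norm nrm K (?a \<bullet>\<^sub>\<phi> y (r i) \<bullet>\<^sub>\<phi> ?a - z)"
              using is_idealD(2)[OF K(1)]
              by (intro always_eventually allI quot_norm_nonneg[OF K_subset(2) _ wA]) auto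
            show "\<forall>\<^sub>F i in sequentially. quot_norm nrm K (?a \<bullet>\<^sub>\<phi> y (r i) \<bullet>\<^sub>\<phi> ?a - z) \<le> cmod (y (r i) 0 x - l) * c"
            proof (intro always_eventually allI)
              fix i
              \<comment> \<open>This element of \<open>K\<close>, given by \<open>red\<close>, is
                the competitor in the infimum defining the quotient norm.\<close>
              let ?k = "?a \<bullet>\<^sub>\<phi> y (r i) \<bullet>\<^sub>\<phi> ?a - scp_scale (y (r i) 0 x) (wmono 0 f2)"
              have "quot_norm nrm K (?a \<bullet>\<^sub>\<phi> y (r i) \<bullet>\<^sub>\<phi> ?a - z) \<le> nrm (?a \<bullet>\<^sub>\<phi> y (r i) \<bullet>\<^sub>\<phi> ?a - z - ?k)"
                using y by (intro quot_norm_le[OF K_subset(2) _ wA] red) auto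
              also have "?a \<bullet>\<^sub>\<phi> y (r i) \<bullet>\<^sub>\<phi> ?a - z - ?k = scp_scale (y (r i) 0 x - l) (wmono 0 f2)"
                by (simp add: z_def scp_scale_def fun_eq_iff algebra_simps)
              also have "nrm \<dots> \<le> cmod (y (r i) 0 x - l) * c"
                using c by (intro scp_norm_le op_bound_scale bdd_wmono) auto
              finally show "quot_norm nrm K (?a \<bullet>\<^sub>\<phi> y (r i) \<bullet>\<^sub>\<phi> ?a - z) \<le> cmod (y (r i) 0 x - l) * c" .
            qed
            have "(\<lambda>i. cmod (y (r i) 0 x - l) * c) \<longlonglongrightarrow> cmod (l - l) * c"
              using r(2) by (intro tendsto_intros) (simp add: o_def)
            then show "(\<lambda>i. cmod (y (r i) 0 x - l) * c) \<longlonglongrightarrow> 0" by simp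
          qed simp
          then show "\<exists>r z. strict_mono r \<and> z \<in> J \<and>
              (\<lambda>i. quot_norm nrm K (?a \<bullet>\<^sub>\<phi> y (r i) \<bullet>\<^sub>\<phi> ?a - z)) \<longlonglongrightarrow> 0"
            using r(1) zJ by blast
        qed
      qed
    qed
    then have "G \<in> \<G>" using G(1,2) by (auto simp: \<G>_def)
    then have "x \<in> V" using G(4) by (auto simp: V_def)
    then show False using G'(2) by blast
  qed
  then show ?thesis using assms by (intro V) (auto intro: C0_on_mono)
qed

lemma J_subset_K: "J \<subseteq> K"
proof
  fix a assume a: "a \<in> J"
  have "wmono n (a n) \<in> K" for n
    using positive_degree_in_K[OF _ J_coeff(1)[OF a], of n] degree_zero_in_K[OF J_coeff(2)[OF a]]
    by (cases "n = 0") auto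
  then show "a \<in> K" by (rule ideal_containing_coeffs[OF K a J_subset])
qed

end

lemma J_hypocompact: "hypocompact J mult scp_scale nrm"
  unfolding hypocompact_def
proof (intro allI impI, rule ccontr)
  fix K
  assume K: "is_ideal J mult scp_scale K \<and> closed_in_alg J nrm K \<and> K \<noteq> J"
    and none: "\<not> (\<exists>a\<in>J. a \<notin> K \<and> compact_elem_quot J mult nrm K a)"
  have "J \<subseteq> K"
    by (rule J_subset_K) (use K none in blast)+
  then show False using K is_idealD(1) by blast
qed

end

section \<open>Every hypocompact ideal lies in \<open>J\<close>\<close>

section \<open>Maximality of the candidate\<close>

lemma funpow_funpow: "(f ^^ m) ((f ^^ n) x) = (f ^^ (m + n)) x"
  by (simp add: funpow_add)

lemma scp_mult_scale_left: "scp_mult \<phi> (scp_scale c a) b = scp_scale c (scp_mult \<phi> a b)"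
  by (simp add: scp_mult_def scp_scale_def fun_eq_iff sum_distrib_left mult.assoc)

lemma scp_mult_scale_right: "scp_mult \<phi> a (scp_scale c b) = scp_scale c (scp_mult \<phi> a b)"
  by (simp add: scp_mult_def scp_scale_def fun_eq_iff sum_distrib_left mult.left_commute)

text \<open>On a forward invariant set, lowest coefficients multiply as in a skew power series ring:
  in every other term of the convolution one factor has too low a degree.\<close>

lemma scp_mult_lowest:
  assumes inv: "\<And>x k. x \<in> R \<Longrightarrow> (\<phi> ^^ k) x \<in> R"
    and a: "\<And>m x. m < p \<Longrightarrow> x \<in> R \<Longrightarrow> a m x = 0"
    and b: "\<And>m x. m < q \<Longrightarrow> x \<in> R \<Longrightarrow> b m x = 0"
    and x: "x \<in> R"
  shows "m < p + q \<Longrightarrow> scp_mult \<phi> a b m x = 0"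
    and "scp_mult \<phi> a b (p + q) x = a p ((\<phi> ^^ q) x) * b q x"
proof -
  assume m: "m < p + q"
  show "scp_mult \<phi> a b m x = 0"
    unfolding scp_mult_def
  proof (intro sum.neutral ballI)
    fix j assume "j \<in> {..m}"
    then have "j < p \<or> m - j < q" using m by auto
    then show "a j ((\<phi> ^^ (m - j)) x) * b (m - j) x = 0"
      using a inv b x by auto
  qed
next
  have "scp_mult \<phi> a b (p + q) x = (\<Sum>j\<in>{p}. a j ((\<phi> ^^ (p + q - j)) x) * b (p + q - j) x)"
    unfolding scp_mult_def
  proof (rule sum.mono_neutral_right)
    show "\<forall>j\<in>{..p + q} - {p}. a j ((\<phi> ^^ (p + q - j)) x) * b (p + q - j) x = 0"
    proof
      fix j assume "j \<in> {..p + q} - {p}"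
      then have "j < p \<or> p + q - j < q" by auto
      then show "a j ((\<phi> ^^ (p + q - j)) x) * b (p + q - j) x = 0"
        using a inv b x by auto
    qed
  qed auto
  then show "scp_mult \<phi> a b (p + q) x = a p ((\<phi> ^^ q) x) * b q x" by simp
qed

context semicrossed_system
begin

lemma recurrent_orbit: "x \<in> recurrent_points X \<phi> \<Longrightarrow> (\<phi> ^^ k) x \<in> recurrent_points X \<phi>"
  by (induction k) (auto intro: recurrent_step)

lemma coeff_zero_on_Y:
  assumes "f \<in> C0 X" "\<And>x. x \<in> recurrent_points X \<phi> \<Longrightarrow> f x = 0" "x \<in> Y"
  shows "f x = 0"
proof -
  have "closedin X {x \<in> topspace X. f x \<in> {0}}"
    by (rule closedin_continuous_map_preimage[OF C0D(1)[OF assms(1)]]) auto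
  moreover have "recurrent_points X \<phi> \<subseteq> {x \<in> topspace X. f x \<in> {0}}"
    using assms(2) recurrent_points_subset[of X \<phi>] by auto
  ultimately have "Y \<subseteq> {x \<in> topspace X. f x \<in> {0}}" by (rule closure_of_minimal[rotated])
  then show ?thesis using assms(3) by blast
qed

text \<open>Multiplication by such monomials keeps the test sequences bounded by
  \<open>nrm a\<close>, whatever the degrees inserted.\<close>

lemma bdd_bump_mult:
  assumes "bdd a c" "\<And>y. cmod (h y) \<le> 1"
  shows "bdd (wmono k h \<bullet>\<^sub>\<phi> a) c" "bdd (a \<bullet>\<^sub>\<phi> wmono k h) c"
  using op_bound_mult[OF bdd_wmono[of 1 h k] assms(1)] op_bound_mult[OF assms(1) bdd_wmono[of 1 h k]] assms(2)
  by simp_all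

section \<open>Elements of an ideal \<open>I\<close> that are compact modulo some \<open>K\<close>
  inside \<open>J\<close>\<close>

context
  fixes I K a
  assumes I: "is_ideal \<A> mult scp_scale I"
    and K: "K \<subseteq> I" "0 \<in> K" "K \<subseteq> J"
    and a: "a \<in> I" "compact_elem_quot I mult nrm K a"
begin

lemma K_subset_A: "K \<subseteq> \<A>"
  using K(3) J_subset by blast

lemma I_subset: "I \<subseteq> \<A>"
  using is_idealD(1)[OF I] .

lemma a_in: "a \<in> \<A>"
  using a(1) I_subset by blast

lemma nrm_a: "0 \<le> nrm a"
  by (rule nrm_nonneg[OF a_in])

text \<open>After rescaling into the unit ball, compactness gives convergence in the quotient norm.
  Since \<open>K\<close> lies in \<open>J\<close>, this dominates the coefficients at the points
  where \<open>J\<close> vanishes, uniformly in degree and point.\<close>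

lemma compact_sequence:
  assumes u: "\<And>i::nat. u i \<in> I" "\<And>i. bdd (u i) (nrm a)"
  obtains r :: "nat \<Rightarrow> nat" and z where "strict_mono r" "z \<in> \<A>"
    "\<forall>e>0. \<exists>N. \<forall>i\<ge>N. \<forall>n t. t \<in> Y \<or> n = 0 \<and> t \<in> P \<longrightarrow>
      cmod ((a \<bullet>\<^sub>\<phi> u (r i) \<bullet>\<^sub>\<phi> a) n t - z n t) < e"
proof -
  \<comment> \<open>The summand 1 keeps the scaling factor finite if the norm is zero.\<close>
  define c where "c = nrm a + 1"
  let ?s = "complex_of_real (1 / c)"
  have c: "0 < c" "nrm a \<le> c" using nrm_a by (auto simp: c_def)
  define y where "y i = scp_scale ?s (u i)" for i
  have yI: "y i \<in> I" for i unfolding y_def by (rule is_idealD(5)[OF I u(1)])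
  have y1: "quot_norm nrm K (y i) \<le> 1" for i
  proof -
    have "bdd (y i) (cmod ?s * nrm a)" unfolding y_def by (rule op_bound_scale[OF u(2)])
    then have "nrm (y i) \<le> cmod ?s * nrm a" by (rule scp_norm_le)
    also have "\<dots> = nrm a / c" using c by (simp add: norm_divide)
    also have "\<dots> \<le> 1" using c by simp
    finally show ?thesis
      using quot_norm_le[OF K_subset_A K(2), of "y i"] yI[of i] I_subset by fastforce
  qed
  obtain r z where r: "strict_mono r" "z \<in> I" "(\<lambda>i. quot_norm nrm K (a \<bullet>\<^sub>\<phi> y (r i) \<bullet>\<^sub>\<phi> a - z)) \<longlonglongrightarrow> 0"
    using a(2)[unfolded compact_elem_quot_def, rule_format, of y] yI y1 by auto
  have zA: "z \<in> \<A>" using r(2) I_subset by blast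
  have "\<exists>N. \<forall>i\<ge>N. \<forall>n t. t \<in> Y \<or> n = 0 \<and> t \<in> P \<longrightarrow>
      cmod ((a \<bullet>\<^sub>\<phi> u (r i) \<bullet>\<^sub>\<phi> a) n t - scp_scale (of_real c) z n t) < e" if e: "0 < e" for e
  proof -
    have "\<forall>\<^sub>F i in sequentially. quot_norm nrm K (a \<bullet>\<^sub>\<phi> y (r i) \<bullet>\<^sub>\<phi> a - z) < e / c"
      by (rule order_tendstoD(2)[OF r(3)]) (use e c in simp)
    then obtain N where N: "\<And>i. N \<le> i \<Longrightarrow> quot_norm nrm K (a \<bullet>\<^sub>\<phi> y (r i) \<bullet>\<^sub>\<phi> a - z) < e / c"
      unfolding eventually_sequentially by blast
    have "cmod ((a \<bullet>\<^sub>\<phi> u (r i) \<bullet>\<^sub>\<phi> a) n t - scp_scale (of_real c) z n t) < e"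
      if i: "N \<le> i" and t: "t \<in> Y \<or> n = 0 \<and> t \<in> P" for i n t
    proof -
      let ?d = "a \<bullet>\<^sub>\<phi> y (r i) \<bullet>\<^sub>\<phi> a - z"
      have dA: "?d \<in> \<A>"
        using yI I_subset zA by (intro diff_in mult_in a_in) auto
      have "cmod (?d n t) \<le> quot_norm nrm K ?d"
        by (rule quot_norm_coeff[OF K_subset_A _ dA]) (use t K(2,3) in \<open>auto simp: J_def\<close>)
      also have "\<dots> < e / c" by (rule N[OF i])
      finally have "c * cmod (?d n t) < e" using c by (simp add: field_simps)
      moreover have "a \<bullet>\<^sub>\<phi> y (r i) \<bullet>\<^sub>\<phi> a = scp_scale ?s (a \<bullet>\<^sub>\<phi> u (r i) \<bullet>\<^sub>\<phi> a)"
        by (simp only: y_def scp_mult_scale_left scp_mult_scale_right)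
      then have "(a \<bullet>\<^sub>\<phi> u (r i) \<bullet>\<^sub>\<phi> a) n t - scp_scale (of_real c) z n t = of_real c * ?d n t"
        using c by (simp add: scp_scale_def algebra_simps)
      ultimately show ?thesis using c by (simp add: norm_mult)
    qed
    then show ?thesis by blast
  qed
  then show ?thesis using that[OF r(1) scale_in[OF zA]] by blast
qed

text \<open>Near \<open>x\<close> there are infinitely many points of \<open>P\<close> with
  \<open>a 0\<close> bounded away from 0. Bumps at these points, inserted between copies of
  \<open>a\<close>, give products whose coefficients in degree 0 stay apart uniformly on
  \<open>P\<close>.\<close>

lemma compact_zero_on_perfect_part:
  assumes x: "x \<in> P"
  shows "a 0 x = 0"
proof (rule ccontr)
  assume ax: "a 0 x \<noteq> 0"
  define c where "c = cmod (a 0 x) / 2"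
  have c: "0 < c" using ax by (simp add: c_def)
  define U where "U = {t \<in> topspace X. cmod (a 0 t) \<in> {c<..}}"
  have xT: "x \<in> topspace X" using x perfect_part_subset[of X] by blast
  have "openin X U"
    unfolding U_def by (rule openin_continuous_map_preimage[OF continuous_map_norm[OF C0D(1)[OF coeff_C0[OF a_in]]]]) auto
  moreover have "x \<in> U" using ax xT by (simp add: U_def c_def)
  moreover have "x \<in> X derived_set_of P" using x perfect_part_subset_derived[of X] by blast
  ultimately have "infinite (P \<inter> U)"
    unfolding derived_set_of_infinite_openin[OF Hausdorff] by blast
  then obtain t :: "nat \<Rightarrow> 'a" where t: "inj t" "range t \<subseteq> P \<inter> U"
    using infinite_countable_subset by blast
  have tT: "t i \<in> topspace X" for i using t(2) by (auto simp: U_def)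
  \<comment> \<open>Vanishing at the earlier points is enough: two terms are compared at the point
    belonging to the smaller index.\<close>
  have "\<exists>h. h \<in> C0 X \<and> (\<forall>y. cmod (h y) \<le> 1) \<and> h (t i) = 1 \<and> (\<forall>j<i. h (t j) = 0)" for i
  proof -
    have "closedin X (t ` {..<i})"
      using tT by (intro closedin_Hausdorff_finite[OF Hausdorff]) auto
    then have "openin X (topspace X - t ` {..<i})" by blast
    moreover have "t i \<in> topspace X - t ` {..<i}" using tT t(1) by (auto simp: inj_eq)
    ultimately obtain h where "h \<in> C0_on X (topspace X - t ` {..<i})" "h (t i) = 1" "\<And>y. cmod (h y) \<le> 1"
      using bump by blast
    then show ?thesis by (auto simp: C0_on_def intro!: exI[of _ h])
  qed
  then obtain h where h: "\<And>i. h i \<in> C0 X" "\<And>i y. cmod (h i y) \<le> 1" "\<And>i. h i (t i) = 1" "\<And>i j. j < i \<Longrightarrow> h i (t j) = 0"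
    by metis
  define u where "u i = wmono 0 (h i) \<bullet>\<^sub>\<phi> a" for i
  have uI: "u i \<in> I" for i
    unfolding u_def by (intro is_idealD(6)[OF I] wmono_in h a(1))
  have ub: "bdd (u i) (nrm a)" for i
    unfolding u_def by (intro bdd_bump_mult(1) bdd_nrm[OF a_in] h)
  obtain r :: "nat \<Rightarrow> nat" and z where r: "strict_mono r" "z \<in> \<A>" and conv: "\<forall>e>0. \<exists>N. \<forall>i\<ge>N. \<forall>n s. s \<in> Y \<or> n = 0 \<and> s \<in> P \<longrightarrow>
      cmod ((a \<bullet>\<^sub>\<phi> u (r i) \<bullet>\<^sub>\<phi> a) n s - z n s) < e"
    by (rule compact_sequence[of u, OF uI ub])
  have coeff: "(a \<bullet>\<^sub>\<phi> u i \<bullet>\<^sub>\<phi> a) 0 s = a 0 s * h i s * a 0 s * a 0 s" for i s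
    by (simp add: u_def scp_mult_def)
  have c3: "0 < c ^ 3" using c by simp
  obtain N where N: "\<And>i s. N \<le> i \<Longrightarrow> s \<in> P \<Longrightarrow> cmod ((a \<bullet>\<^sub>\<phi> u (r i) \<bullet>\<^sub>\<phi> a) 0 s - z 0 s) < c ^ 3 / 2"
    using conv[rule_format, of "c ^ 3 / 2"] c3 by auto
  \<comment> \<open>At this point term \<open>N\<close> equals \<open>a 0 s ^ 3\<close> and term
    \<open>N + 1\<close> is zero, yet both are within \<open>c ^ 3 / 2\<close> of
    \<open>z 0 s\<close>.\<close>
  define s where "s = t (r N)"
  have sP: "s \<in> P" and sc: "c < cmod (a 0 s)" using t(2) by (auto simp: s_def U_def)
  have "(a \<bullet>\<^sub>\<phi> u (r N) \<bullet>\<^sub>\<phi> a) 0 s = a 0 s ^ 3"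
    by (simp add: coeff s_def h(3) power3_eq_cube)
  then have 1: "cmod (a 0 s ^ 3 - z 0 s) < c ^ 3 / 2" using N[of N s] sP by simp
  have "r N < r (Suc N)" using r(1) by (simp add: strict_mono_Suc_iff)
  then have "(a \<bullet>\<^sub>\<phi> u (r (Suc N)) \<bullet>\<^sub>\<phi> a) 0 s = 0"
    by (simp add: coeff s_def h(4))
  then have 2: "cmod (z 0 s) < c ^ 3 / 2" using N[of "Suc N" s] sP by simp
  have "c ^ 3 \<le> cmod (a 0 s) ^ 3" using c sc by (intro power_mono) auto
  moreover have "cmod (a 0 s ^ 3) \<le> cmod (a 0 s ^ 3 - z 0 s) + cmod (z 0 s)"
    using norm_triangle_ineq[of "a 0 s ^ 3 - z 0 s" "z 0 s"] by simp
  ultimately show False using 1 2 by (simp add: norm_power)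
qed

text \<open>In \<open>a U^k h a U^l h' a\<close> the lowest coefficient is a product of three values
  of \<open>a p\<close> along the orbit of \<open>x\<close>. With \<open>k\<close> and
  \<open>l\<close> adapted to the return times these values stay large while the degree tends to
  infinity, against the decay of coefficients of the limit.\<close>

lemma compact_zero_on_recurrent:
  assumes xR: "x \<in> recurrent_points X \<phi>"
  shows "a n x = 0"
proof (rule ccontr)
  let ?R = "recurrent_points X \<phi>"
  assume "a n x \<noteq> 0"
  then have ex: "\<exists>n. \<exists>x\<in>?R. a n x \<noteq> 0" using xR by blast
  \<comment> \<open>Minimality is taken over all recurrent points, so that the lower coefficients
    vanish along whole orbits; \<open>x\<close> is then chosen anew for this degree.\<close>
  define p where "p = (LEAST n. \<exists>x\<in>?R. a n x \<noteq> 0)"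
  obtain x where x: "x \<in> ?R" "a p x \<noteq> 0"
    using LeastI_ex[OF ex] by (auto simp: p_def)
  have low: "a m y = 0" if "m < p" "y \<in> ?R" for m y
    using not_less_Least[of m "\<lambda>n. \<exists>x\<in>?R. a n x \<noteq> 0"] that by (auto simp: p_def)
  have xT: "x \<in> topspace X" using x(1) recurrent_points_subset[of X \<phi>] by blast
  have xY: "x \<in> Y" using x(1) closure_of_subset[OF recurrent_points_subset[of X \<phi>]] by blast
  obtain q where q: "strict_mono q" "limitin X (\<lambda>i. (\<phi> ^^ q i) x) x sequentially"
    using x(1) by (auto simp: recurrent_points_def)
  define c where "c = cmod (a p x) / 2"
  have c: "0 < c" using x(2) by (simp add: c_def)
  have "limitin euclidean (a p \<circ> (\<lambda>i. (\<phi> ^^ q i) x)) (a p x) sequentially"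
    by (rule continuous_map_limit[OF C0D(1)[OF coeff_C0[OF a_in]] q(2)])
  then have "(\<lambda>i. a p ((\<phi> ^^ q i) x)) \<longlonglongrightarrow> a p x" by (simp add: o_def)
  then have "(\<lambda>i. cmod (a p ((\<phi> ^^ q i) x))) \<longlonglongrightarrow> cmod (a p x)" by (rule tendsto_norm)
  then have "\<forall>\<^sub>F i in sequentially. c < cmod (a p ((\<phi> ^^ q i) x))"
    by (rule order_tendstoD(1)) (use x(2) in \<open>simp add: c_def\<close>)
  then obtain i0 where i0: "\<And>i. i0 \<le> i \<Longrightarrow> c < cmod (a p ((\<phi> ^^ q i) x))"
    unfolding eventually_sequentially by blast
  have qi: "i \<le> q i" for i using q(1) by (rule strict_mono_imp_increasing)
  \<comment> \<open>Makes \<open>l + p\<close> a return time beyond \<open>i0\<close>. Since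
    \<open>i \<le> q i\<close>, the subtraction is exact.\<close>
  define l where "l = q (i0 + p) - p"
  have pl: "l + p = q (i0 + p)" using qi[of "i0 + p"] by (simp add: l_def)
  \<comment> \<open>Makes \<open>k i + 2 * p + l\<close> a return time; the index is large enough
    for exact subtraction and for the lower bound from \<open>i0\<close>.\<close>
  define k where "k i = q (i + i0 + 2 * p + l) - (2 * p + l)" for i
  have k: "k i + (2 * p + l) = q (i + i0 + 2 * p + l)" for i
    using qi[of "i + i0 + 2 * p + l"] by (simp add: k_def)
  \<comment> \<open>The bumps \<open>h\<close> and \<open>h'\<close> equal 1 at the orbit points
    where the lowest coefficient evaluates them, and have modulus at most 1.\<close>
  obtain h where h: "h \<in> C0_on X (topspace X)" "h ((\<phi> ^^ (2 * p + l)) x) = 1" "\<And>y. cmod (h y) \<le> 1"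
    using bump[OF openin_topspace orbit_in[OF xT]] by blast
  obtain h' where h': "h' \<in> C0_on X (topspace X)" "h' ((\<phi> ^^ p) x) = 1" "\<And>y. cmod (h' y) \<le> 1"
    using bump[OF openin_topspace orbit_in[OF xT]] by blast
  define u where "u i = wmono (k i) h \<bullet>\<^sub>\<phi> a \<bullet>\<^sub>\<phi> wmono l h'" for i
  have uI: "u i \<in> I" for i
    unfolding u_def by (intro is_idealD(6,7)[OF I] wmono_in C0_onD(1)[OF h(1)] C0_onD(1)[OF h'(1)] a(1))
  have ub: "bdd (u i) (nrm a)" for i
    unfolding u_def by (intro bdd_bump_mult bdd_nrm[OF a_in] h h')
  obtain r :: "nat \<Rightarrow> nat" and z where r: "strict_mono r" "z \<in> \<A>" and conv: "\<forall>e>0. \<exists>N. \<forall>i\<ge>N. \<forall>n s. s \<in> Y \<or> n = 0 \<and> s \<in> P \<longrightarrow>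
      cmod ((a \<bullet>\<^sub>\<phi> u (r i) \<bullet>\<^sub>\<phi> a) n s - z n s) < e"
    by (rule compact_sequence[of u, OF uI ub])
  have orb: "(\<phi> ^^ m) y \<in> ?R" if "y \<in> ?R" for y m
    by (rule recurrent_orbit[OF that])
  have wlow: "wmono m f j y = 0" if "j < m" for m f j and y :: 'a
    using that by (simp add: wmono_apply)
  define d where "d i = p + (k i + p + l) + p" for i
  \<comment> \<open>Four uses of \<open>scp_mult_lowest\<close>, from the innermost product
    outwards, on the forward invariant set of recurrent points.\<close>
  have coeff: "(a \<bullet>\<^sub>\<phi> u i \<bullet>\<^sub>\<phi> a) (d i) x =
      a p ((\<phi> ^^ q (i + i0 + 2 * p + l)) x) * a p ((\<phi> ^^ q (i0 + p)) x) * a p x" for i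
  proof -
    let ?v = "wmono (k i) h \<bullet>\<^sub>\<phi> a"
    have v1: "?v m y = 0" if "m < k i + p" "y \<in> ?R" for m y
      by (rule scp_mult_lowest(1)[where R = ?R and p = "k i" and q = p]; use orb wlow low that in blast)
    have v2: "?v (k i + p) y = h ((\<phi> ^^ p) y) * a p y" if "y \<in> ?R" for y
    proof -
      have "?v (k i + p) y = wmono (k i) h (k i) ((\<phi> ^^ p) y) * a p y"
        by (rule scp_mult_lowest(2)[where R = ?R]; use orb wlow low that in blast)
      then show ?thesis by simp
    qed
    have w1: "u i m y = 0" if "m < k i + p + l" "y \<in> ?R" for m y
      unfolding u_def
      by (rule scp_mult_lowest(1)[where R = ?R and p = "k i + p" and q = l]; use orb wlow v1 that in blast)
    have w2: "u i (k i + p + l) y = ?v (k i + p) ((\<phi> ^^ l) y) * h' y" if "y \<in> ?R" for y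
    proof -
      have "u i (k i + p + l) y = ?v (k i + p) ((\<phi> ^^ l) y) * wmono l h' l y"
        unfolding u_def by (rule scp_mult_lowest(2)[where R = ?R]; use orb wlow v1 that in blast)
      then show ?thesis by simp
    qed
    have e1: "(a \<bullet>\<^sub>\<phi> u i) m y = 0" if "m < p + (k i + p + l)" "y \<in> ?R" for m y
      by (rule scp_mult_lowest(1)[where R = ?R and p = p and q = "k i + p + l"]; use orb low w1 that in blast)
    have e2: "(a \<bullet>\<^sub>\<phi> u i) (p + (k i + p + l)) y = a p ((\<phi> ^^ (k i + p + l)) y) * u i (k i + p + l) y" if "y \<in> ?R" for y
      by (rule scp_mult_lowest(2)[where R = ?R]; use orb low w1 that in blast)
    have "(a \<bullet>\<^sub>\<phi> u i \<bullet>\<^sub>\<phi> a) (d i) x = (a \<bullet>\<^sub>\<phi> u i) (p + (k i + p + l)) ((\<phi> ^^ p) x) * a p x"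
      unfolding d_def by (rule scp_mult_lowest(2)[where R = ?R]; use orb e1 low x(1) in blast)
    also have "(a \<bullet>\<^sub>\<phi> u i) (p + (k i + p + l)) ((\<phi> ^^ p) x) =
        a p ((\<phi> ^^ (k i + p + l)) ((\<phi> ^^ p) x)) * (h ((\<phi> ^^ p) ((\<phi> ^^ l) ((\<phi> ^^ p) x))) * a p ((\<phi> ^^ l) ((\<phi> ^^ p) x)) * h' ((\<phi> ^^ p) x))"
      using x(1) by (simp only: e2 w2 v2 orb)
    also have "(\<phi> ^^ (k i + p + l)) ((\<phi> ^^ p) x) = (\<phi> ^^ (k i + (2 * p + l))) x"
      unfolding funpow_funpow by (rule arg_cong[where f = "\<lambda>j. (\<phi> ^^ j) x"]) simp
    also have "(\<phi> ^^ p) ((\<phi> ^^ l) ((\<phi> ^^ p) x)) = (\<phi> ^^ (2 * p + l)) x"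
      unfolding funpow_funpow by (rule arg_cong[where f = "\<lambda>j. (\<phi> ^^ j) x"]) simp
    also have "(\<phi> ^^ l) ((\<phi> ^^ p) x) = (\<phi> ^^ (l + p)) x"
      by (simp add: funpow_add)
    finally show ?thesis by (simp add: k pl h(2) h'(2))
  qed
  have big: "c ^ 3 < cmod ((a \<bullet>\<^sub>\<phi> u i \<bullet>\<^sub>\<phi> a) (d i) x)" for i
  proof -
    have "c * c * c < cmod (a p ((\<phi> ^^ q (i + i0 + 2 * p + l)) x)) * cmod (a p ((\<phi> ^^ q (i0 + p)) x)) * cmod (a p x)"
      using c x(2) i0[of "i + i0 + 2 * p + l"] i0[of "i0 + p"]
      by (intro mult_strict_mono') (auto simp: c_def)
    then show ?thesis by (simp add: coeff norm_mult power3_eq_cube)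
  qed
  have c3: "0 < c ^ 3 / 2" using c by simp
  \<comment> \<open>Convergence at \<open>x\<close> is uniform in the degree \<open>m\<close>, so it
    may be used in a degree \<open>d j\<close> that grows with the index.\<close>
  obtain N where N: "\<And>i m. N \<le> i \<Longrightarrow> cmod ((a \<bullet>\<^sub>\<phi> u (r i) \<bullet>\<^sub>\<phi> a) m x - z m x) < c ^ 3 / 2"
    using conv[rule_format, OF c3] xY by blast
  obtain N' where N': "\<And>m y. N' \<le> m \<Longrightarrow> cmod (z m y) \<le> c ^ 3 / 2"
    using coeff_decay[OF r(2) c3] by blast
  define j where "j = r (max N N')"
  have "N' \<le> j" using strict_mono_imp_increasing[OF r(1), of "max N N'"] by (simp add: j_def)
  also have "j \<le> d j" using qi[of "j + i0 + 2 * p + l"] k[of j] by (simp add: d_def)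
  finally have "cmod (z (d j) x) \<le> c ^ 3 / 2" by (rule N')
  moreover have "cmod ((a \<bullet>\<^sub>\<phi> u j \<bullet>\<^sub>\<phi> a) (d j) x - z (d j) x) < c ^ 3 / 2"
    using N[of "max N N'" "d j"] by (simp add: j_def)
  moreover have "cmod ((a \<bullet>\<^sub>\<phi> u j \<bullet>\<^sub>\<phi> a) (d j) x) \<le> cmod ((a \<bullet>\<^sub>\<phi> u j \<bullet>\<^sub>\<phi> a) (d j) x - z (d j) x) + cmod (z (d j) x)"
    using norm_triangle_ineq[of "(a \<bullet>\<^sub>\<phi> u j \<bullet>\<^sub>\<phi> a) (d j) x - z (d j) x" "z (d j) x"] by simp
  ultimately show False using big[of j] by linarith
qed

lemma compact_in_J: "a \<in> J"
  using compact_zero_on_perfect_part a_in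
    coeff_zero_on_Y[OF coeff_C0[OF a_in] compact_zero_on_recurrent]
  by (auto simp: J_def)

end

lemma closed_in_J: "closed_in_alg I nrm (I \<inter> J)" if "I \<subseteq> \<A>"
  unfolding closed_in_alg_def
proof (intro allI impI, elim conjE)
  fix k x assume k: "\<forall>i::nat. k i \<in> I \<inter> J" and x: "x \<in> I" and lim: "(\<lambda>i. nrm (k i - x)) \<longlonglongrightarrow> 0"
  have "x n t = 0" if "t \<in> Y \<or> n = 0 \<and> t \<in> P" for n t
  proof -
    have "cmod (x n t) \<le> nrm (k i - x)" for i
    proof -
      have "k i \<in> J" "x \<in> \<A>" using k x \<open>I \<subseteq> \<A>\<close> by auto
      then have "k i - x \<in> \<A>" "k i n t = 0" using J_subset that by (auto simp: J_def intro: diff_in)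
      then show ?thesis using coeff_le_nrm[of "k i - x" n t] by simp
    qed
    then have "cmod (x n t) \<le> 0" using LIMSEQ_le_const[OF lim] by blast
    then show ?thesis by simp
  qed
  then show "x \<in> I \<inter> J" using x \<open>I \<subseteq> \<A>\<close> by (auto simp: J_def)
qed

text \<open>Apply hypocompactness to the closed ideal \<open>I \<inter> J\<close>: if proper, it
  leaves room for an element outside \<open>J\<close> that is compact modulo it, contrary to
  \<open>compact_in_J\<close>.\<close>

lemma hypocompact_ideal_subset_J:
  assumes I: "is_ideal \<A> mult scp_scale I" and hyp: "hypocompact I mult scp_scale nrm"
  shows "I \<subseteq> J"
proof (rule ccontr)
  assume "\<not> I \<subseteq> J"
  then have "I \<inter> J \<noteq> I" by blast
  moreover have IA: "I \<subseteq> \<A>" by (rule is_idealD(1)[OF I])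
  moreover have "is_ideal I mult scp_scale (I \<inter> J)"
    using I J_ideal IA unfolding is_ideal_def by blast
  ultimately obtain a where a: "a \<in> I" "a \<notin> I \<inter> J" "compact_elem_quot I mult nrm (I \<inter> J) a"
    using hyp closed_in_J[OF IA] unfolding hypocompact_def by blast
  have "a \<in> J"
    by (rule compact_in_J[OF I _ _ _ a(1,3)]) (use is_idealD(2)[OF I] is_idealD(2)[OF J_ideal] in auto)
  then show False using a by blast
qed

lemma J_is_hypocompact_radical: "is_hypocompact_radical \<A> mult scp_scale nrm J"
  unfolding is_hypocompact_radical_def
  using J_ideal J_hypocompact hypocompact_ideal_subset_J by blast

end

theorem theorem2p6:
  fixes X :: "'a topology" and \<phi> :: "'a \<Rightarrow> 'a"
  assumes "metrizable_space X" and "locally_compact_space X"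
    and "homeomorphic_map X X \<phi>"
  shows "is_hypocompact_radical (semicrossed X \<phi>) (scp_mult \<phi>) scp_scale (scp_norm X \<phi>)
           {a \<in> semicrossed X \<phi>. (\<forall>x \<in> perfect_part X. a 0 x = 0) \<and>
              (\<forall>n. \<forall>x \<in> X closure_of recurrent_points X \<phi>. a n x = 0)}"
proof -
  interpret semicrossed_system X \<phi>
    using assms homeomorphic_imp_continuous_map by unfold_locales auto
  show ?thesis
    using J_is_hypocompact_radical unfolding J_def .
qed

end
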